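(* Let $\gamma>2$ and let $f:(0,\infty)\to\mathbb R$ be twice differentiable with continuous second derivative satisfying $f''(t)=t^{\gamma-2+o(1)}$ as $t\to\infty$, i.e. for every $\varepsilon>0$ one has $t^{\gamma-2-\varepsilon}\leqslant f''(t)\leqslant t^{\gamma-2+\varepsilon}$ for all sufficiently large $t$. Let $\mathbf a=(a_n)_{n=1}^\infty$ be a sequence of complex numbers with $|a_n|=1$. Then there is a constant $c>0$ (which may depend on $f$) such that for every interval $\mathfrak I\subseteq\mathbb R$ the set of $x\in\mathfrak I$ satisfying $$\Big|\sum_{1\leqslant n\leqslant N} a_n\,\mathbf e(xf(n))\Big|\geqslant cN^{1/2}\quad\text{for infinitely many } N\in\mathbb N$$ has Hausdorff dimension at least $1-1/(2\gamma)$.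
   Context: $\mathbf e(x)=\exp(2\pi i x)$. *)

theory Defs
  imports "HOL-Analysis.Analysis"
begin

definition unit_exp :: "real \<Rightarrow> complex" where
  "unit_exp x = exp (2 * of_real pi * \<i> * of_real x)"

(* Convention (diam U)^0 = 1 for nonempty U and 0 for empty U, so that the 0-dimensional Hausdorff
   measure is counting measure; the case split is needed because 0 powr 0 = 0. *)
definition diam_power :: "real \<Rightarrow> 'a::metric_space set \<Rightarrow> ennreal" where
  "diam_power s U =
     (if s = 0 then (if U = {} then 0 else 1) else ennreal (diameter U powr s))"

(* Boundedness is required separately, since diameter is an unspecified real number on
   unbounded sets. Finite covers are included by padding with empty sets. *)
definition hausdorff_premeasure :: "real \<Rightarrow> real \<Rightarrow> 'a::metric_space set \<Rightarrow> ennreal" where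
  "hausdorff_premeasure s \<delta> A =
     (INF U \<in> {U :: nat \<Rightarrow> 'a set.
                A \<subseteq> (\<Union>i. U i) \<and> (\<forall>i. bounded (U i) \<and> diameter (U i) \<le> \<delta>)}.
        \<Sum>i. diam_power s (U i))"

definition hausdorff_measure :: "real \<Rightarrow> 'a::metric_space set \<Rightarrow> ennreal" where
  "hausdorff_measure s A = (SUP \<delta> \<in> {0<..}. hausdorff_premeasure s \<delta> A)"

definition hausdorff_dim :: "'a::metric_space set \<Rightarrow> ereal" where
  "hausdorff_dim A = (INF s \<in> {s. 0 \<le> s \<and> hausdorff_measure s A = 0}. ereal s)"

end

theory Submission
  imports Defs "HOL-Real_Asymp.Real_Asymp"
begin

text \<open>
  Let \<open>B\<close> be the block sum over \<open>N < n \<le> 2 N\<close>; if \<open>\<bar>B\<bar>\<close> is large at \<open>x\<close>, then so is the partial sum up to \<open>N\<close>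
  or up to \<open>2 N\<close>. Put \<open>D = f' N\<close> and \<open>H = D \<surd>N\<close>, and split the block into windows on which
  \<open>\<lfloor>f n / H\<rfloor>\<close> is constant, so that a window has at most \<open>\<surd>N + 1\<close> terms. Let \<open>Q\<close> be the sum of the squared
  absolute values of the window sums. Convexity of \<open>f\<close> separates the numbers \<open>f (y + d) - f y\<close> for each
  fixed \<open>d \<ge> 1\<close>, which yields \<open>\<integral>\<^sub>J Q\<^sup>2 = O (N\<^sup>2 \<bar>J\<bar>)\<close>; for \<open>\<bar>B\<bar>\<^sup>4\<close> no such bound is available.
  On a cell of length \<open>1 / H\<close> the sum \<open>B\<close> is a combination of the orthogonal exponentials of frequencies
  \<open>j H\<close> with almost constant coefficients, hence \<open>\<integral> \<bar>B\<bar>\<^sup>2 = O (\<integral> Q)\<close> over the cell. Together with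
  \<open>\<integral>\<^sub>J \<bar>B\<bar>\<^sup>2 \<ge> N \<bar>J\<bar> / 2\<close> this shows that on a positive proportion of the cells \<open>\<bar>B\<bar>\<^sup>2\<close> has mean of order
  \<open>N\<close> while \<open>Q = O (N)\<close>. As there are at most \<open>N\<close> to the power \<open>1 / 2 + o (1)\<close> windows, on such a cell
  \<open>\<bar>B\<bar>\<^sup>2\<close> is at most \<open>N\<close> to the power \<open>3 / 2 + o (1)\<close>, so that \<open>\<bar>B\<bar>\<close> exceeds \<open>\<surd>N / 4\<close> on a subset of measure
  \<open>N\<close> to the power \<open>- \<gamma> - o (1)\<close>. The cells have length \<open>N\<close> to the power \<open>- \<gamma> + 1 / 2 + o (1)\<close> and are
  evenly distributed, so iterating the selection produces Cantor sets of every dimension below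
  \<open>(\<gamma> - 1 / 2) / \<gamma>\<close>.
\<close>

section \<open>Integrals of exponentials\<close>

lemma unit_exp_eq_cis: "unit_exp x = cis (2 * pi * x)"
  by (simp add: unit_exp_def cis_conv_exp mult_ac)

lemma unit_exp_add: "unit_exp (x + y) = unit_exp x * unit_exp y"
  by (simp add: unit_exp_eq_cis cis_mult distrib_left)

lemma norm_unit_exp [simp]: "norm (unit_exp x) = 1"
  by (simp add: unit_exp_eq_cis)

lemma cnj_unit_exp: "cnj (unit_exp x) = unit_exp (- x)"
  by (simp add: unit_exp_eq_cis cis_cnj)

lemma unit_exp_0 [simp]: "unit_exp 0 = 1"
  by (simp add: unit_exp_def)

lemma unit_exp_of_int [simp]: "unit_exp (of_int k) = 1"
  by (simp add: unit_exp_eq_cis cis.ctr complex_eq_iff cos_int_2pin sin_int_2pin)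

lemma continuous_on_unit_exp [continuous_intros]:
  "continuous_on S g \<Longrightarrow> continuous_on S (\<lambda>x. unit_exp (g x))"
  unfolding unit_exp_def by (intro continuous_intros)

lemma has_vector_derivative_unit_exp:
  "((\<lambda>x. unit_exp (x * \<xi>)) has_vector_derivative
      of_real (2 * pi * \<xi>) * \<i> * unit_exp (x * \<xi>)) (at x within S)"
proof -
  have "((\<lambda>z. exp (2 * of_real pi * \<i> * (z * of_real \<xi>))) has_field_derivative
      of_real (2 * pi * \<xi>) * \<i> * unit_exp (x * \<xi>)) (at (of_real x))"
    by (auto intro!: derivative_eq_intros simp: unit_exp_def)
  then have "((\<lambda>x. exp (2 * of_real pi * \<i> * (of_real x * of_real \<xi>))) has_vector_derivative
      of_real (2 * pi * \<xi>) * \<i> * unit_exp (x * \<xi>)) (at x within S)"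
    by (rule has_vector_derivative_real_field)
  then show ?thesis
    by (simp add: unit_exp_def)
qed

text \<open>For positive \<open>l\<close> this is the minimum of \<open>l\<close> and
  \<open>1 / \<bar>\<xi>\<bar>\<close>, the two trivial bounds for an exponential integral over an
  interval of length \<open>l\<close>. Taking the maximum in the denominator gives the value
  \<open>l\<close> at frequency 0, where the convention 1 / 0 = 0 would spoil the minimum.\<close>

definition osc_bound :: "real \<Rightarrow> real \<Rightarrow> real" where
  "osc_bound l \<xi> = 1 / max (1 / l) \<bar>\<xi>\<bar>"

lemma osc_bound_minus [simp]: "osc_bound l (- \<xi>) = osc_bound l \<xi>"
  by (simp add: osc_bound_def)

lemma osc_bound_nonneg: "l > 0 \<Longrightarrow> osc_bound l \<xi> \<ge> 0"
  by (simp add: osc_bound_def max_def)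

lemma osc_bound_le_length: "l > 0 \<Longrightarrow> osc_bound l \<xi> \<le> l"
proof -
  assume "l > 0"
  then have "1 / max (1 / l) \<bar>\<xi>\<bar> \<le> 1 / (1 / l)"
    by (intro divide_left_mono mult_pos_pos) (auto simp: less_max_iff_disj)
  then show ?thesis by (simp add: osc_bound_def)
qed

lemma osc_bound_le_inverse: "l > 0 \<Longrightarrow> 0 < t \<Longrightarrow> t \<le> \<bar>\<xi>\<bar> \<Longrightarrow> osc_bound l \<xi> \<le> 1 / t"
  unfolding osc_bound_def by (intro divide_left_mono) (auto simp: max_def)

lemma norm_integral_unit_exp_le:
  assumes "a < b"
  shows "norm (integral {a..b} (\<lambda>x. unit_exp (x * \<xi>))) \<le> osc_bound (b - a) \<xi>"
proof -
  have 1: "norm (integral {a..b} (\<lambda>x. unit_exp (x * \<xi>))) \<le> b - a"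
  proof -
    have "continuous_on {a..b} (\<lambda>x. unit_exp (x * \<xi>))" by (intro continuous_intros)
    from integral_bound[OF _ this, of 1] show ?thesis using assms by simp
  qed
  have 2: "norm (integral {a..b} (\<lambda>x. unit_exp (x * \<xi>))) \<le> 1 / \<bar>\<xi>\<bar>" if "\<xi> \<noteq> 0"
  proof -
    have "((\<lambda>x. unit_exp (x * \<xi>) / (of_real (2 * pi * \<xi>) * \<i>)) has_vector_derivative
            unit_exp (x * \<xi>)) (at x within {a..b})" for x
      using has_vector_derivative_mult_left[OF has_vector_derivative_unit_exp[of \<xi> x "{a..b}"],
          of "1 / (of_real (2 * pi * \<xi>) * \<i>)"] that
      by (simp add: field_simps)
    then have "((\<lambda>x. unit_exp (x * \<xi>)) has_integral
        (unit_exp (b * \<xi>) / (of_real (2 * pi * \<xi>) * \<i>) - unit_exp (a * \<xi>) / (of_real (2 * pi * \<xi>) * \<i>))) {a..b}"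
      using assms by (intro fundamental_theorem_of_calculus) auto
    then have "integral {a..b} (\<lambda>x. unit_exp (x * \<xi>)) =
        (unit_exp (b * \<xi>) - unit_exp (a * \<xi>)) / (of_real (2 * pi * \<xi>) * \<i>)"
      by (simp add: integral_unique diff_divide_distrib)
    also have "norm \<dots> = norm (unit_exp (b * \<xi>) - unit_exp (a * \<xi>)) / (2 * pi * \<bar>\<xi>\<bar>)"
      by (simp add: norm_divide norm_mult abs_mult)
    also have "\<dots> \<le> 2 / (2 * pi * \<bar>\<xi>\<bar>)"
      using norm_triangle_ineq4[of "unit_exp (b * \<xi>)" "unit_exp (a * \<xi>)"]
      by (intro divide_right_mono) auto
    also have "\<dots> \<le> 1 / \<bar>\<xi>\<bar>"
      using that pi_gt3 by (simp add: field_simps)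
    finally show ?thesis .
  qed
  show ?thesis
  proof (cases "1 / (b - a) \<le> \<bar>\<xi>\<bar>")
    case True
    moreover have "1 / (b - a) > 0" using assms by simp
    ultimately have "0 < \<bar>\<xi>\<bar>" by linarith
    then have "\<xi> \<noteq> 0" by simp
    with 2 True show ?thesis by (simp add: osc_bound_def max_def)
  qed (use 1 in \<open>simp add: osc_bound_def max_def\<close>)
qed

lemma norm_integral_trig_sum_le:
  assumes "a < b" and "\<And>i. i \<in> A \<Longrightarrow> norm (c i) \<le> 1"
  shows "norm (integral {a..b} (\<lambda>x. \<Sum>i\<in>A. c i * unit_exp (x * \<xi> i))) \<le> (\<Sum>i\<in>A. osc_bound (b - a) (\<xi> i))"
proof (cases "finite A")
  case True
  have "integral {a..b} (\<lambda>x. \<Sum>i\<in>A. c i * unit_exp (x * \<xi> i))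
      = (\<Sum>i\<in>A. c i * integral {a..b} (\<lambda>x. unit_exp (x * \<xi> i)))"
    by (subst integral_sum[OF True])
       (auto intro!: integrable_continuous_interval continuous_intros)
  also have "norm \<dots> \<le> (\<Sum>i\<in>A. osc_bound (b - a) (\<xi> i))"
  proof (rule sum_norm_le)
    fix i assume "i \<in> A"
    then have "norm (c i * integral {a..b} (\<lambda>x. unit_exp (x * \<xi> i))) \<le> 1 * osc_bound (b - a) (\<xi> i)"
      unfolding norm_mult using assms norm_integral_unit_exp_le[OF assms(1)]
      by (intro mult_mono) auto
    then show "norm (c i * integral {a..b} (\<lambda>x. unit_exp (x * \<xi> i))) \<le> osc_bound (b - a) (\<xi> i)"
      by simp
  qed
  finally show ?thesis .
qed simp

section \<open>Oscillatory bounds summed over separated frequencies\<close>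

lemma sum_inverse_dist_le:
  fixes N y0 :: nat
  assumes "Y \<subseteq> {N<..2 * N}" "y0 \<in> Y"
  shows "(\<Sum>y\<in>Y - {y0}. 1 / \<bar>real y - real y0\<bar>) \<le> 2 * harm N"
proof -
  have fin: "finite Y" using assms finite_subset by blast
  have range: "N < y \<and> y \<le> 2 * N" if "y \<in> Y" for y using that assms(1) by auto
  have right: "(\<Sum>y\<in>{y\<in>Y. y0 < y}. 1 / \<bar>real y - real y0\<bar>) \<le> harm N"
  proof -
    have "(\<Sum>y\<in>{y\<in>Y. y0 < y}. 1 / \<bar>real y - real y0\<bar>)
        = (\<Sum>k\<in>(\<lambda>y. y - y0) ` {y\<in>Y. y0 < y}. inverse (real k))"
      by (subst sum.reindex) (auto simp: inj_on_def inverse_eq_divide of_nat_diff intro!: sum.cong)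
    also have "\<dots> \<le> (\<Sum>k=1..N. inverse (real k))"
      using assms by (intro sum_mono2) (auto dest!: range)
    finally show ?thesis by (simp add: harm_def)
  qed
  have left: "(\<Sum>y\<in>{y\<in>Y. y < y0}. 1 / \<bar>real y - real y0\<bar>) \<le> harm N"
  proof -
    have "(\<Sum>y\<in>{y\<in>Y. y < y0}. 1 / \<bar>real y - real y0\<bar>)
        = (\<Sum>k\<in>(\<lambda>y. y0 - y) ` {y\<in>Y. y < y0}. inverse (real k))"
      by (subst sum.reindex) (auto simp: inj_on_def inverse_eq_divide of_nat_diff intro!: sum.cong)
    also have "\<dots> \<le> (\<Sum>k=1..N. inverse (real k))"
      using assms by (intro sum_mono2) (auto dest!: range)
    finally show ?thesis by (simp add: harm_def)
  qed
  have split: "Y - {y0} = {y\<in>Y. y0 < y} \<union> {y\<in>Y. y < y0}" by auto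
  have "(\<Sum>y\<in>Y - {y0}. 1 / \<bar>real y - real y0\<bar>) =
      (\<Sum>y\<in>{y\<in>Y. y0 < y}. 1 / \<bar>real y - real y0\<bar>) + (\<Sum>y\<in>{y\<in>Y. y < y0}. 1 / \<bar>real y - real y0\<bar>)"
    unfolding split by (rule sum.union_disjoint) (use fin in auto)
  then show ?thesis using left right by simp
qed

text \<open>Only the frequency \<open>\<zeta> y0\<close> closest to 0 can contribute the full length
  \<open>l\<close>. By minimality any other frequency has at least half the size of its distance
  from \<open>\<zeta> y0\<close>, hence at least half of \<open>g\<close> times the distance of the
  indices. These terms add up to a harmonic sum, which \<open>small\<close> bounds by another
  \<open>l\<close>.\<close>

lemma sum_osc_bound_separated:
  fixes \<zeta> :: "nat \<Rightarrow> real"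
  assumes "l > 0" "g > 0" "Y \<subseteq> {N<..2 * N}"
    and sep: "\<And>y y'. y \<in> Y \<Longrightarrow> y' \<in> Y \<Longrightarrow> y < y' \<Longrightarrow> \<bar>\<zeta> y' - \<zeta> y\<bar> \<ge> g * (real y' - real y)"
    and small: "4 * harm N \<le> g * l"
  shows "(\<Sum>y\<in>Y. osc_bound l (\<zeta> y)) \<le> 2 * l"
proof (cases "Y = {}")
  case True then show ?thesis using assms by simp
next
  case False
  have fin: "finite Y" using assms finite_subset by blast
  define y0 where "y0 = arg_min_on (\<lambda>y. \<bar>\<zeta> y\<bar>) Y"
  have y0: "y0 \<in> Y" "\<And>y. y \<in> Y \<Longrightarrow> \<bar>\<zeta> y0\<bar> \<le> \<bar>\<zeta> y\<bar>"
    unfolding y0_def using arg_min_if_finite(1)[OF fin False] arg_min_least[OF fin False] by auto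
  have "osc_bound l (\<zeta> y) \<le> 2 / g * (1 / \<bar>real y - real y0\<bar>)" if "y \<in> Y - {y0}" for y
  proof -
    have "g * \<bar>real y - real y0\<bar> \<le> \<bar>\<zeta> y - \<zeta> y0\<bar>"
      using sep[of y y0] sep[of y0 y] that y0(1) by (cases "y < y0") (auto simp: abs_if split: if_splits)
    also have "\<dots> \<le> 2 * \<bar>\<zeta> y\<bar>"
      using y0(2)[of y] that by auto
    finally have "g * \<bar>real y - real y0\<bar> / 2 \<le> \<bar>\<zeta> y\<bar>" by simp
    then have "osc_bound l (\<zeta> y) \<le> 1 / (g * \<bar>real y - real y0\<bar> / 2)"
      using assms(1,2) that by (intro osc_bound_le_inverse) auto
    then show ?thesis by (simp add: field_simps)
  qed
  then have "(\<Sum>y\<in>Y - {y0}. osc_bound l (\<zeta> y)) \<le> 2 / g * (\<Sum>y\<in>Y - {y0}. 1 / \<bar>real y - real y0\<bar>)"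
    unfolding sum_distrib_left by (intro sum_mono) auto
  also have "\<dots> \<le> 2 / g * (2 * harm N)"
    using assms y0 by (intro mult_left_mono sum_inverse_dist_le) auto
  also have "\<dots> \<le> l" using small assms(2) by (simp add: field_simps)
  finally have "(\<Sum>y\<in>Y - {y0}. osc_bound l (\<zeta> y)) \<le> l" .
  moreover have "(\<Sum>y\<in>Y. osc_bound l (\<zeta> y)) = osc_bound l (\<zeta> y0) + (\<Sum>y\<in>Y - {y0}. osc_bound l (\<zeta> y))"
    by (rule sum.remove[OF fin y0(1)])
  ultimately show ?thesis
    using osc_bound_le_length[OF assms(1), of "\<zeta> y0"] by simp
qed

section \<open>Windows and their second moment\<close>

lemma integral_real_trig_poly_le:
  fixes Q :: "real \<Rightarrow> real"
  assumes "a < b" and "\<And>i. i \<in> A \<Longrightarrow> norm (c i) \<le> 1"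
    and "\<And>x. complex_of_real (Q x) = (\<Sum>i\<in>A. c i * unit_exp (x * \<xi> i))"
  shows "integral {a..b} Q \<le> (\<Sum>i\<in>A. osc_bound (b - a) (\<xi> i))"
proof -
  have int: "(\<lambda>x. \<Sum>i\<in>A. c i * unit_exp (x * \<xi> i)) integrable_on {a..b}"
    by (intro integrable_continuous_interval continuous_intros)
  have "Q = (\<lambda>x. Re (\<Sum>i\<in>A. c i * unit_exp (x * \<xi> i)))"
    using assms(3) by (metis Re_complex_of_real)
  then have "integral {a..b} Q = Re (integral {a..b} (\<lambda>x. \<Sum>i\<in>A. c i * unit_exp (x * \<xi> i)))"
    using integral_linear[OF int bounded_linear_Re] by (simp add: o_def)
  also have "\<dots> \<le> norm (integral {a..b} (\<lambda>x. \<Sum>i\<in>A. c i * unit_exp (x * \<xi> i)))"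
    by (rule complex_Re_le_cmod)
  also have "\<dots> \<le> (\<Sum>i\<in>A. osc_bound (b - a) (\<xi> i))"
    by (rule norm_integral_trig_sum_le) (use assms in auto)
  finally show ?thesis .
qed

text \<open>The quantity Q of the overview. The coefficients are a parameter because Q is also used
  with each coefficient weighted by \<open>frac (F n / H)\<close>, the weight produced by
  differentiating a window sum demodulated by a multiple of \<open>H\<close>.\<close>

definition window_square ::
    "(nat \<Rightarrow> real) \<Rightarrow> (nat \<Rightarrow> int) \<Rightarrow> nat set \<Rightarrow> (nat \<Rightarrow> complex) \<Rightarrow> real \<Rightarrow> real" where
  "window_square F w A b x =
     (\<Sum>j\<in>w ` A. (norm (\<Sum>n\<in>{n\<in>A. w n = j}. b n * unit_exp (x * F n)))\<^sup>2)"

definition window_pairs :: "(nat \<Rightarrow> int) \<Rightarrow> nat set \<Rightarrow> (nat \<times> nat) set" where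
  "window_pairs w A = {(n, m). n \<in> A \<and> m \<in> A \<and> w n = w m}"

lemma finite_window_pairs: "finite A \<Longrightarrow> finite (window_pairs w A)"
  by (rule finite_subset[of _ "A \<times> A"]) (auto simp: window_pairs_def)

lemma window_square_nonneg: "window_square F w A b x \<ge> 0"
  unfolding window_square_def by (intro sum_nonneg) auto

lemma continuous_on_window_square [continuous_intros]:
  "continuous_on S (window_square F w A b)"
  unfolding window_square_def by (intro continuous_intros)

lemma window_square_eq_pair_sum:
  assumes "finite A"
  shows "complex_of_real (window_square F w A b x) =
    (\<Sum>p\<in>window_pairs w A. (b (fst p) * cnj (b (snd p))) * unit_exp (x * (F (fst p) - F (snd p))))"
proof -
  define h where "h n m = (b n * cnj (b m)) * unit_exp (x * (F n - F m))" for n m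
  have h: "b n * unit_exp (x * F n) * cnj (b m * unit_exp (x * F m)) = h n m" for n m
    unfolding h_def right_diff_distrib
    using unit_exp_add[of "x * F n" "- (x * F m)"] by (simp add: cnj_unit_exp)
  have "complex_of_real (window_square F w A b x) =
      (\<Sum>j\<in>w ` A. \<Sum>n\<in>{n\<in>A. w n = j}. \<Sum>m\<in>{m\<in>A. w m = j}. h n m)"
    unfolding window_square_def of_real_sum complex_norm_square cnj_sum sum_product h ..
  also have "\<dots> = (\<Sum>j\<in>w ` A. \<Sum>n\<in>{n\<in>A. w n = j}. \<Sum>m\<in>{m\<in>A. w m = w n}. h n m)"
    by (intro sum.cong) auto
  also have "\<dots> = (\<Sum>n\<in>A. \<Sum>m\<in>{m\<in>A. w m = w n}. h n m)"
    by (rule sum.image_gen[symmetric, OF assms])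
  also have "\<dots> = (\<Sum>p\<in>(SIGMA n:A. {m\<in>A. w m = w n}). h (fst p) (snd p))"
    using assms by (subst sum.Sigma) (auto simp: case_prod_beta)
  also have "(SIGMA n:A. {m\<in>A. w m = w n}) = window_pairs w A"
    by (auto simp: window_pairs_def)
  finally show ?thesis by (simp add: h_def)
qed

text \<open>Sorts the pairs by their signed gap: the diagonal, then the gaps 1 to \<open>K\<close>
  in either order. Sets of pairs with a fixed gap are the ones on which convexity separates
  frequencies. Since \<open>h\<close> is nonnegative, pairs that straddle two windows may be
  added.\<close>

lemma sum_window_pairs_le:
  fixes h :: "nat \<Rightarrow> nat \<Rightarrow> real"
  assumes fin: "finite A" and near: "\<And>n m. n \<in> A \<Longrightarrow> m \<in> A \<Longrightarrow> w n = w m \<Longrightarrow> m \<le> n + K"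
    and nonneg: "\<And>n m. h n m \<ge> 0"
  shows "(\<Sum>p\<in>window_pairs w A. h (fst p) (snd p)) \<le>
    (\<Sum>y\<in>A. h y y) + (\<Sum>d=1..K. \<Sum>y\<in>{y\<in>A. y + d \<in> A}. h (y + d) y)
      + (\<Sum>d=1..K. \<Sum>y\<in>{y\<in>A. y + d \<in> A}. h y (y + d))"
proof -
  define S where "S = (SIGMA d:{1..K}. {y\<in>A. y + d \<in> A})"
  have finS: "finite S" unfolding S_def using fin by auto
  define B0 B1 B2 where "B0 = (\<lambda>y. (y, y)) ` A" and "B1 = (\<lambda>(d, y). (y + d, y)) ` S"
    and "B2 = (\<lambda>(d, y). (y, y + d)) ` S"
  let ?h = "\<lambda>p. h (fst p) (snd p)"
  have "p \<in> B0 \<union> B1 \<union> B2" if p: "p \<in> window_pairs w A" for p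
  proof -
    obtain n m where nm: "p = (n, m)" "n \<in> A" "m \<in> A" "w n = w m"
      using p by (auto simp: window_pairs_def)
    consider "n = m" | "m < n" | "n < m" by linarith
    then show ?thesis
    proof cases
      case 1 then show ?thesis using nm by (auto simp: B0_def)
    next
      case 2
      then have "(n - m, m) \<in> S" using nm near[of m n] by (auto simp: S_def)
      then have "(case (n - m, m) of (d, y) \<Rightarrow> (y + d, y)) \<in> B1" unfolding B1_def by (rule imageI)
      then show ?thesis using 2 nm by simp
    next
      case 3
      then have "(m - n, n) \<in> S" using nm near[of n m] by (auto simp: S_def)
      then have "(case (m - n, n) of (d, y) \<Rightarrow> (y, y + d)) \<in> B2" unfolding B2_def by (rule imageI)
      then show ?thesis using 3 nm by simp
    qed
  qed
  then have "(\<Sum>p\<in>window_pairs w A. ?h p) \<le> (\<Sum>p\<in>B0 \<union> B1 \<union> B2. ?h p)"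
    using nonneg fin finS by (intro sum_mono2) (auto simp: B0_def B1_def B2_def)
  also have "\<dots> \<le> (\<Sum>p\<in>B0 \<union> B1. ?h p) + (\<Sum>p\<in>B2. ?h p)"
    using nonneg fin finS
    by (subst sum.union_inter[symmetric]) (auto simp: B0_def B1_def B2_def intro!: sum_nonneg)
  also have "(\<Sum>p\<in>B0 \<union> B1. ?h p) \<le> (\<Sum>p\<in>B0. ?h p) + (\<Sum>p\<in>B1. ?h p)"
    using nonneg fin finS
    by (subst sum.union_inter[symmetric]) (auto simp: B0_def B1_def intro!: sum_nonneg)
  also have "(\<Sum>p\<in>B0. ?h p) = (\<Sum>y\<in>A. h y y)"
    unfolding B0_def by (subst sum.reindex) (auto simp: inj_on_def)
  also have "(\<Sum>p\<in>B1. ?h p) = (\<Sum>(d, y)\<in>S. h (y + d) y)"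
    unfolding B1_def by (subst sum.reindex) (auto simp: inj_on_def case_prod_beta)
  also have "\<dots> = (\<Sum>d=1..K. \<Sum>y\<in>{y\<in>A. y + d \<in> A}. h (y + d) y)"
    unfolding S_def using fin by (subst sum.Sigma) auto
  also have "(\<Sum>p\<in>B2. ?h p) = (\<Sum>(d, y)\<in>S. h y (y + d))"
    unfolding B2_def by (subst sum.reindex) (auto simp: inj_on_def case_prod_beta)
  also have "\<dots> = (\<Sum>d=1..K. \<Sum>y\<in>{y\<in>A. y + d \<in> A}. h y (y + d))"
    unfolding S_def using fin by (subst sum.Sigma) auto
  finally show ?thesis by simp
qed

text \<open>Expanding the square gives a trigonometric polynomial over pairs of pairs, with
  frequencies \<open>z\<close> plus a difference of two values of \<open>F\<close>. For fixed
  \<open>z\<close> the inner sum is at most \<open>N * osc_bound l z + 4 * K * l\<close>. Summing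
  over \<open>z\<close> uses the same estimate once more. As \<open>K\<close> is at most the square
  root of \<open>N\<close>, the total N l (N + 8 K + 8 K^2) is at most 17 N^2 l.\<close>

lemma integral_window_square_power2_le:
  fixes F :: "nat \<Rightarrow> real"
  assumes "a < b" "g > 0"
    and coeff: "\<And>n. n \<in> {N<..2 * N} \<Longrightarrow> norm (c n) \<le> 1"
    and near: "\<And>n m. n \<in> {N<..2 * N} \<Longrightarrow> m \<in> {N<..2 * N} \<Longrightarrow> w n = w m \<Longrightarrow> real m - real n \<le> sqrt N"
    and convex: "\<And>y y' d. N < y \<Longrightarrow> y < y' \<Longrightarrow> 1 \<le> d \<Longrightarrow> y' + d \<le> 2 * N \<Longrightarrow>
        (F (y' + d) - F y') - (F (y + d) - F y) \<ge> g * (real y' - real y)"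
    and harm: "4 * harm N \<le> g * (b - a)"
  shows "integral {a..b} (\<lambda>x. (window_square F w {N<..2 * N} c x)\<^sup>2) \<le> 17 * (real N)\<^sup>2 * (b - a)"
proof -
  define A where "A = {N<..2 * N}"
  define l where "l = b - a"
  define K where "K = nat \<lfloor>sqrt N\<rfloor>"
  define R where "R = window_pairs w A"
  have l: "l > 0" using assms by (simp add: l_def)
  have K_le: "real K \<le> sqrt N" by (simp add: K_def)
  have K2: "real K * real K \<le> real N"
    using mult_mono[OF K_le K_le] by simp
  have KN: "real K \<le> real N"
  proof (cases "K = 0")
    case False
    then have "real K * 1 \<le> real K * real K" by (intro mult_left_mono) auto
    with K2 show ?thesis by simp
  qed simp
  have near': "m \<le> n + K" if "n \<in> A" "m \<in> A" "w n = w m" for n m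
  proof (cases "n \<le> m")
    case True
    have "real m - real n \<le> sqrt N" using near[of n m] that by (simp add: A_def)
    then have "real (m - n) \<le> sqrt N" using True by (simp add: of_nat_diff)
    then have "m - n \<le> K" unfolding K_def by (rule le_nat_floor)
    then show ?thesis by simp
  qed simp
  have [simp]: "finite A" "card A = N" by (simp_all add: A_def)
  have finR: "finite R" unfolding R_def by (rule finite_window_pairs) simp
  \<comment> \<open>The shift \<open>z\<close> is the frequency of the other pair; adding it leaves
    the separation by \<open>g\<close> unchanged.\<close>
  have up: "(\<Sum>y\<in>{y\<in>A. y + d \<in> A}. osc_bound l (z + (F (y + d) - F y))) \<le> 2 * l" if "1 \<le> d" for d z
  proof (rule sum_osc_bound_separated[OF l \<open>g > 0\<close>])
    fix y y' assume "y \<in> {y \<in> A. y + d \<in> A}" "y' \<in> {y \<in> A. y + d \<in> A}" "y < y'"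
    then have "(F (y' + d) - F y') - (F (y + d) - F y) \<ge> g * (real y' - real y)"
      using that by (intro convex) (auto simp: A_def)
    then show "g * (real y' - real y) \<le> \<bar>z + (F (y' + d) - F y') - (z + (F (y + d) - F y))\<bar>"
      by simp
  qed (use harm in \<open>auto simp: A_def l_def\<close>)
  \<comment> \<open>Reversing the pair changes the sign of its difference, so evenness of
    \<open>osc_bound\<close> reduces this to \<open>up\<close> at \<open>- z\<close>.\<close>
  have down: "(\<Sum>y\<in>{y\<in>A. y + d \<in> A}. osc_bound l (z + (F y - F (y + d)))) \<le> 2 * l" if "1 \<le> d" for d z
  proof -
    have "osc_bound l (z + (F y - F (y + d))) = osc_bound l (- z + (F (y + d) - F y))" for y
      using osc_bound_minus[of l "z + (F y - F (y + d))"] by (simp add: algebra_simps)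
    then show ?thesis using up[OF that, of "- z"] by simp
  qed
  have inner: "(\<Sum>q\<in>R. osc_bound l (z + (F (fst q) - F (snd q)))) \<le> N * osc_bound l z + 4 * K * l" for z
  proof -
    have "(\<Sum>q\<in>R. osc_bound l (z + (F (fst q) - F (snd q)))) \<le>
      (\<Sum>y\<in>A. osc_bound l (z + (F y - F y)))
      + (\<Sum>d=1..K. \<Sum>y\<in>{y\<in>A. y + d \<in> A}. osc_bound l (z + (F (y + d) - F y)))
      + (\<Sum>d=1..K. \<Sum>y\<in>{y\<in>A. y + d \<in> A}. osc_bound l (z + (F y - F (y + d))))"
      unfolding R_def using near' l by (intro sum_window_pairs_le) (auto intro: osc_bound_nonneg)
    also have "\<dots> \<le> N * osc_bound l z + (\<Sum>d=1..K. 2 * l) + (\<Sum>d=1..K. 2 * l)"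
      by (intro add_mono sum_mono up down) auto
    finally show ?thesis by (simp add: algebra_simps)
  qed
  have "real (card R) = (\<Sum>q\<in>R. (\<lambda>n m. 1) (fst q) (snd q))" by simp
  also have "\<dots> \<le> (\<Sum>y\<in>A. 1) + (\<Sum>d=1..K. \<Sum>y\<in>{y\<in>A. y + d \<in> A}. 1)
      + (\<Sum>d=1..K. \<Sum>y\<in>{y\<in>A. y + d \<in> A}. 1)"
    unfolding R_def using near' by (intro sum_window_pairs_le) auto
  also have "\<dots> \<le> N + (\<Sum>d=1..K. real N) + (\<Sum>d=1..K. real N)"
  proof -
    have "card {y\<in>A. y + d \<in> A} \<le> N" for d
      using card_mono[of A "{y\<in>A. y + d \<in> A}"] by auto
    then show ?thesis by (intro add_mono sum_mono) auto
  qed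
  finally have cardR: "real (card R) \<le> N * (2 * K + 1)" by (simp add: algebra_simps)
  let ?c = "\<lambda>p. c (fst p) * cnj (c (snd p))"
  let ?x = "\<lambda>p. F (fst p) - F (snd p)"
  have "complex_of_real ((window_square F w A c x)\<^sup>2) =
      (\<Sum>i\<in>R \<times> R. (?c (fst i) * ?c (snd i)) * unit_exp (x * (?x (fst i) + ?x (snd i))))" for x
  proof -
    have "complex_of_real ((window_square F w A c x)\<^sup>2) =
        (\<Sum>p\<in>R. ?c p * unit_exp (x * ?x p)) * (\<Sum>q\<in>R. ?c q * unit_exp (x * ?x q))"
      by (simp add: window_square_eq_pair_sum R_def power2_eq_square)
    also have "\<dots> = (\<Sum>p\<in>R. \<Sum>q\<in>R. (?c p * ?c q) * unit_exp (x * (?x p + ?x q)))"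
      unfolding sum_product
    proof (intro sum.cong refl)
      fix p q
      have "unit_exp (x * (?x p + ?x q)) = unit_exp (x * ?x p) * unit_exp (x * ?x q)"
        unfolding distrib_left by (rule unit_exp_add)
      then show "?c p * unit_exp (x * ?x p) * (?c q * unit_exp (x * ?x q)) =
          (?c p * ?c q) * unit_exp (x * (?x p + ?x q))"
        by (simp only: mult_ac)
    qed
    finally show ?thesis using finR by (simp add: sum.cartesian_product case_prod_beta)
  qed
  then have "integral {a..b} (\<lambda>x. (window_square F w A c x)\<^sup>2) \<le>
      (\<Sum>i\<in>R \<times> R. osc_bound (b - a) (?x (fst i) + ?x (snd i)))"
  proof (intro integral_real_trig_poly_le[where c = "\<lambda>i. ?c (fst i) * ?c (snd i)"])
    fix i assume "i \<in> R \<times> R"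
    then have "fst (fst i) \<in> A" "snd (fst i) \<in> A" "fst (snd i) \<in> A" "snd (snd i) \<in> A"
      by (auto simp: R_def window_pairs_def)
    then show "norm (?c (fst i) * ?c (snd i)) \<le> 1"
      using coeff by (auto simp: norm_mult A_def intro!: mult_le_one)
  qed (use \<open>a < b\<close> in auto)
  also have "\<dots> = (\<Sum>p\<in>R. \<Sum>q\<in>R. osc_bound l (?x p + ?x q))"
    unfolding l_def using finR by (simp add: sum.cartesian_product case_prod_beta)
  also have "\<dots> \<le> (\<Sum>p\<in>R. N * osc_bound l (?x p) + 4 * K * l)"
    by (intro sum_mono inner)
  \<comment> \<open>The summand 0 is kept so that \<open>inner\<close> applies a second time, now at
    \<open>z = 0\<close>.\<close>
  also have "\<dots> = N * (\<Sum>p\<in>R. osc_bound l (0 + ?x p)) + real (card R) * (4 * K * l)"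
    by (simp add: sum.distrib sum_distrib_left)
  also have "\<dots> \<le> N * (N * osc_bound l 0 + 4 * K * l) + N * (2 * K + 1) * (4 * K * l)"
    using cardR l by (intro add_mono mult_left_mono inner mult_right_mono) auto
  also have "\<dots> \<le> N * (N * l + 4 * K * l) + N * (2 * K + 1) * (4 * K * l)"
    using osc_bound_le_length[OF l, of 0] by (intro add_mono mult_left_mono) auto
  also have "\<dots> = N * l * (N + 8 * K + 8 * (real K * K))"
    by (simp add: algebra_simps)
  also have "\<dots> \<le> N * l * (17 * N)"
    using K2 KN l by (intro mult_left_mono) auto
  finally show ?thesis
    by (simp add: A_def l_def power2_eq_square mult_ac)
qed

section \<open>Mean values\<close>

text \<open>The diagonal contributes \<open>card A * (b - a)\<close>. Each off-diagonal integral is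
  at most \<open>1 / D\<close>, so by \<open>small\<close> all of them together remove at most half
  of that. Working with \<open>card A\<close> minus the square turns the lower bound into an upper
  bound for an off-diagonal polynomial.\<close>

lemma integral_norm_trig_poly_power2_ge:
  fixes F :: "nat \<Rightarrow> real"
  assumes "a < b" "D > 0" "finite A" and coeff: "\<And>n. n \<in> A \<Longrightarrow> norm (c n) = 1"
    and sep: "\<And>n m. n \<in> A \<Longrightarrow> m \<in> A \<Longrightarrow> n \<noteq> m \<Longrightarrow> \<bar>F n - F m\<bar> \<ge> D"
    and small: "2 * real (card A) \<le> D * (b - a)"
  shows "integral {a..b} (\<lambda>x. (norm (\<Sum>n\<in>A. c n * unit_exp (x * F n)))\<^sup>2) \<ge> card A / 2 * (b - a)"
proof (cases "A = {}")
  case False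
  let ?B = "\<lambda>x. (norm (\<Sum>n\<in>A. c n * unit_exp (x * F n)))\<^sup>2"
  define R where "R = {p \<in> A \<times> A. fst p \<noteq> snd p}"
  let ?h = "\<lambda>x p. (c (fst p) * cnj (c (snd p))) * unit_exp (x * (F (fst p) - F (snd p)))"
  have eq: "complex_of_real (card A - ?B x) = (\<Sum>p\<in>R. - (c (fst p) * cnj (c (snd p))) * unit_exp (x * (F (fst p) - F (snd p))))" for x
  proof -
    \<comment> \<open>A constant window map has a single window, so the pair expansion of window
      squares covers the full sum.\<close>
    have "?B x = window_square F (\<lambda>_. 0) A c x"
      using False by (simp add: window_square_def image_constant_conv)
    then have "complex_of_real (?B x) = (\<Sum>p\<in>window_pairs (\<lambda>_. 0) A. ?h x p)"
      by (simp only: window_square_eq_pair_sum[OF assms(3)])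
    also have "window_pairs (\<lambda>_. 0) A = (\<lambda>n. (n, n)) ` A \<union> R"
      by (auto simp: window_pairs_def R_def)
    also have "(\<Sum>p\<in>\<dots>. ?h x p) = (\<Sum>p\<in>(\<lambda>n. (n, n)) ` A. ?h x p) + (\<Sum>p\<in>R. ?h x p)"
      using assms(3) by (intro sum.union_disjoint) (auto simp: R_def)
    also have "(\<Sum>p\<in>(\<lambda>n. (n, n)) ` A. ?h x p) = (\<Sum>n\<in>A. c n * cnj (c n))"
      by (subst sum.reindex) (auto simp: inj_on_def)
    also have "\<dots> = (\<Sum>n\<in>A. 1)"
      using coeff by (intro sum.cong) (simp_all add: complex_norm_square[symmetric])
    finally show ?thesis by (simp add: sum_negf)
  qed
  have int: "?B integrable_on {a..b}"
    by (intro integrable_continuous_interval continuous_intros)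
  have "card A * (b - a) - integral {a..b} ?B = integral {a..b} (\<lambda>x. card A - ?B x)"
    using int \<open>a < b\<close> by (subst Henstock_Kurzweil_Integration.integral_diff) auto
  also have "\<dots> \<le> (\<Sum>p\<in>R. osc_bound (b - a) (F (fst p) - F (snd p)))"
    by (rule integral_real_trig_poly_le[OF \<open>a < b\<close> _ eq])
       (use coeff in \<open>auto simp: R_def norm_mult\<close>)
  also have "\<dots> \<le> (\<Sum>p\<in>R. 1 / D)"
    using assms by (intro sum_mono osc_bound_le_inverse) (auto simp: R_def)
  also have "\<dots> \<le> (\<Sum>p\<in>A \<times> A. 1 / D)"
    using assms by (intro sum_mono2) (auto simp: R_def)
  also have "\<dots> = card A * (card A / D)"
    by (simp add: card_cartesian_product)
  also have "\<dots> \<le> card A * ((b - a) / 2)"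
    using small \<open>D > 0\<close> by (intro mult_left_mono) (auto simp: field_simps)
  finally show ?thesis by (simp add: field_simps)
qed simp

text \<open>Cauchy-Schwarz against the constant 1, obtained from the nonnegative integral of
  \<open>(h x - m)\<^sup>2\<close> with \<open>m\<close> the mean of \<open>h\<close>.\<close>

lemma integral_power2_le:
  fixes h :: "real \<Rightarrow> real"
  assumes "a < b" and cont: "continuous_on {a..b} h"
  shows "(integral {a..b} h)\<^sup>2 \<le> (b - a) * integral {a..b} (\<lambda>x. (h x)\<^sup>2)"
proof -
  define m where "m = integral {a..b} h / (b - a)"
  have int: "h integrable_on {a..b}" "(\<lambda>x. (h x)\<^sup>2) integrable_on {a..b}"
    using cont by (auto intro!: integrable_continuous_interval continuous_intros)
  have "((\<lambda>x. (h x)\<^sup>2 - 2 * m * h x + m\<^sup>2) has_integral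
      (integral {a..b} (\<lambda>x. (h x)\<^sup>2) - 2 * m * integral {a..b} h + (b - a) *\<^sub>R m\<^sup>2)) {a..b}"
    using \<open>a < b\<close> has_integral_const_real[of "m\<^sup>2" a b]
    by (intro has_integral_add has_integral_diff has_integral_mult_right integrable_integral int) simp
  moreover have "(h x)\<^sup>2 - 2 * m * h x + m\<^sup>2 = (h x - m)\<^sup>2" for x
    by (simp add: power2_diff)
  ultimately have "((\<lambda>x. (h x - m)\<^sup>2) has_integral
      (integral {a..b} (\<lambda>x. (h x)\<^sup>2) - 2 * m * integral {a..b} h + (b - a) *\<^sub>R m\<^sup>2)) {a..b}"
    by simp
  then have "0 \<le> integral {a..b} (\<lambda>x. (h x)\<^sup>2) - 2 * m * integral {a..b} h + m\<^sup>2 * (b - a)"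
    using has_integral_nonneg[of "\<lambda>x. (h x - m)\<^sup>2" _ "{a..b}"] by (simp add: mult.commute)
  also have "\<dots> = integral {a..b} (\<lambda>x. (h x)\<^sup>2) - (integral {a..b} h)\<^sup>2 / (b - a)"
    using \<open>a < b\<close> by (simp add: m_def power2_eq_square)
  finally show ?thesis using \<open>a < b\<close> by (simp add: field_simps)
qed

text \<open>Two values of \<open>\<phi>\<close> differ by at most the integral of the norm of the
  derivative, whose square Cauchy-Schwarz controls. Comparing \<open>\<phi> x\<close> with
  \<open>\<phi> y\<close> and averaging over \<open>y\<close> gives the claim. The lemma expresses
  that a function with small derivative on a cell is bounded by its mean square.\<close>

lemma norm_power2_le_Sobolev:
  fixes \<phi> \<phi>' :: "real \<Rightarrow> complex"
  assumes "a < b" and x: "x \<in> {a..b}"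
    and deriv: "\<And>v. v \<in> {a..b} \<Longrightarrow> (\<phi> has_vector_derivative \<phi>' v) (at v within {a..b})"
    and cont: "continuous_on {a..b} \<phi>'"
  shows "(norm (\<phi> x))\<^sup>2 \<le> 2 / (b - a) * integral {a..b} (\<lambda>v. (norm (\<phi> v))\<^sup>2)
           + 2 * (b - a) * integral {a..b} (\<lambda>v. (norm (\<phi>' v))\<^sup>2)"
proof -
  define I where "I = integral {a..b} (\<lambda>v. norm (\<phi>' v))"
  define E where "E = integral {a..b} (\<lambda>v. (norm (\<phi>' v))\<^sup>2)"
  have I2: "I\<^sup>2 \<le> (b - a) * E"
    unfolding I_def E_def by (intro integral_power2_le \<open>a < b\<close> continuous_intros cont)
  have cont\<phi>: "continuous_on {a..b} \<phi>"
    using deriv by (meson continuous_on_eq_continuous_within has_vector_derivative_continuous)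
  have diff: "norm (\<phi> z - \<phi> y) \<le> I" if "a \<le> y" "y \<le> z" "z \<le> b" for y z
  proof -
    have sub: "{y..z} \<subseteq> {a..b}" using that by auto
    have "(\<phi>' has_integral (\<phi> z - \<phi> y)) {y..z}"
      using that sub by (intro fundamental_theorem_of_calculus)
        (auto intro: has_vector_derivative_within_subset[OF deriv])
    then have "\<phi> z - \<phi> y = integral {y..z} \<phi>'" by (simp add: integral_unique)
    also have "norm \<dots> \<le> integral {y..z} (\<lambda>v. norm (\<phi>' v))"
      using continuous_on_subset[OF cont sub]
      by (intro integral_norm_bound_integral integrable_continuous_interval continuous_intros) auto
    also have "\<dots> \<le> I"
      unfolding I_def using continuous_on_subset[OF cont sub] cont sub
      by (intro integral_subset_le integrable_continuous_interval continuous_intros) auto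
    finally show ?thesis .
  qed
  have "(norm (\<phi> x))\<^sup>2 \<le> 2 * (norm (\<phi> y))\<^sup>2 + 2 * (b - a) * E" if "y \<in> {a..b}" for y
  proof -
    have "norm (\<phi> x - \<phi> y) \<le> I"
      using diff[of y x] diff[of x y] x that by (cases "y \<le> x") (auto simp: norm_minus_commute)
    then have "norm (\<phi> x) \<le> norm (\<phi> y) + I"
      using norm_triangle_ineq2[of "\<phi> x" "\<phi> y"] by linarith
    then have "(norm (\<phi> x))\<^sup>2 \<le> (norm (\<phi> y) + I)\<^sup>2"
      by (intro power_mono) auto
    also have "\<dots> \<le> 2 * (norm (\<phi> y))\<^sup>2 + 2 * I\<^sup>2"
      using sum_squares_bound[of "norm (\<phi> y)" I] by (simp add: power2_sum)
    finally show ?thesis using I2 by linarith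
  qed
  then have "integral {a..b} (\<lambda>y. (norm (\<phi> x))\<^sup>2) \<le>
      integral {a..b} (\<lambda>y. 2 * (norm (\<phi> y))\<^sup>2 + 2 * (b - a) * E)"
    by (intro integral_le integrable_continuous_interval continuous_intros cont\<phi>) auto
  also have "\<dots> = 2 * integral {a..b} (\<lambda>y. (norm (\<phi> y))\<^sup>2) + (b - a) * (2 * (b - a) * E)"
    using \<open>a < b\<close> by (subst Henstock_Kurzweil_Integration.integral_add)
      (auto intro!: integrable_continuous_interval continuous_intros cont\<phi>)
  finally show ?thesis
    using \<open>a < b\<close> unfolding E_def by (simp add: field_simps)
qed

text \<open>Parseval over one full period: exponentials whose frequencies are integer multiples of
  \<open>H\<close> are orthogonal on every interval of length \<open>1 / H\<close>.\<close>

lemma integral_norm_periodic_power2: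
  fixes c :: "int \<Rightarrow> complex"
  assumes "H > 0" "finite Z"
  shows "integral {a..a + 1 / H} (\<lambda>x. (norm (\<Sum>j\<in>Z. c j * unit_exp (x * (H * j))))\<^sup>2)
           = (\<Sum>j\<in>Z. (norm (c j))\<^sup>2) / H"
proof -
  let ?I = "{a..a + 1 / H}"
  have orth: "((\<lambda>x. unit_exp (x * (H * real_of_int j - H * real_of_int k))) has_integral
      (if j = k then of_real (1 / H) else 0)) ?I" for j k
  proof (cases "j = k")
    case True
    then show ?thesis
      using \<open>H > 0\<close> has_integral_const_real[of "1 :: complex" a "a + 1 / H"]
      by (simp add: scaleR_conv_of_real)
  next
    case False
    define \<xi> where "\<xi> = H * real_of_int j - H * real_of_int k"
    have \<xi>: "\<xi> \<noteq> 0" using False \<open>H > 0\<close> by (simp add: \<xi>_def)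
    have "((\<lambda>x. unit_exp (x * \<xi>) / (of_real (2 * pi * \<xi>) * \<i>)) has_vector_derivative
            unit_exp (x * \<xi>)) (at x within ?I)" for x
      using has_vector_derivative_mult_left[OF has_vector_derivative_unit_exp[of \<xi> x ?I],
          of "1 / (of_real (2 * pi * \<xi>) * \<i>)"] \<xi>
      by (simp add: field_simps)
    then have "((\<lambda>x. unit_exp (x * \<xi>)) has_integral
        (unit_exp ((a + 1 / H) * \<xi>) / (of_real (2 * pi * \<xi>) * \<i>) - unit_exp (a * \<xi>) / (of_real (2 * pi * \<xi>) * \<i>))) ?I"
      using \<open>H > 0\<close> by (intro fundamental_theorem_of_calculus) auto
    \<comment> \<open>Over one period the phase advances by the integer \<open>j - k\<close>, so the
      antiderivative takes the same value at both ends.\<close>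
    moreover have "(a + 1 / H) * \<xi> = a * \<xi> + of_int (j - k)"
      using \<open>H > 0\<close> by (simp add: \<xi>_def field_simps)
    then have "unit_exp ((a + 1 / H) * \<xi>) = unit_exp (a * \<xi>)"
      by (simp only: unit_exp_add unit_exp_of_int mult_1_right)
    ultimately show ?thesis
      using False by (simp add: \<xi>_def)
  qed
  let ?T = "\<lambda>x. \<Sum>j\<in>Z. \<Sum>k\<in>Z. (c j * cnj (c k)) * unit_exp (x * (H * real_of_int j - H * real_of_int k))"
  have expand: "complex_of_real ((norm (\<Sum>j\<in>Z. c j * unit_exp (x * (H * j))))\<^sup>2) = ?T x" for x
    unfolding complex_norm_square cnj_sum sum_product
  proof (intro sum.cong refl)
    fix j k
    show "c j * unit_exp (x * (H * real_of_int j)) * cnj (c k * unit_exp (x * (H * real_of_int k)))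
        = c j * cnj (c k) * unit_exp (x * (H * real_of_int j - H * real_of_int k))"
      using unit_exp_add[of "x * (H * j)" "- (x * (H * k))"]
      by (simp add: cnj_unit_exp right_diff_distrib)
  qed
  have "(?T has_integral (\<Sum>j\<in>Z. \<Sum>k\<in>Z. (c j * cnj (c k)) * (if j = k then of_real (1 / H) else 0))) ?I"
    by (intro has_integral_sum has_integral_mult_right orth \<open>finite Z\<close>)
  also have "(\<Sum>j\<in>Z. \<Sum>k\<in>Z. (c j * cnj (c k)) * (if j = k then of_real (1 / H) else 0))
      = (\<Sum>j\<in>Z. c j * cnj (c j) * of_real (1 / H))"
  proof (rule sum.cong[OF refl])
    fix j assume "j \<in> Z"
    have "(\<Sum>k\<in>Z. (c j * cnj (c k)) * (if j = k then of_real (1 / H) else 0))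
        = (\<Sum>k\<in>Z. if j = k then c j * cnj (c k) * of_real (1 / H) else 0)"
      by (intro sum.cong) auto
    also have "\<dots> = c j * cnj (c j) * of_real (1 / H)"
      using \<open>j \<in> Z\<close> \<open>finite Z\<close> by (simp only: sum.delta' if_True)
    finally show "(\<Sum>k\<in>Z. (c j * cnj (c k)) * (if j = k then of_real (1 / H) else 0)) = c j * cnj (c j) * of_real (1 / H)" .
  qed
  also have "\<dots> = of_real ((\<Sum>j\<in>Z. (norm (c j))\<^sup>2) / H)"
    unfolding complex_norm_square[symmetric] of_real_mult[symmetric] of_real_sum[symmetric]
    by (simp add: sum_divide_distrib)
  finally have "(?T has_integral of_real ((\<Sum>j\<in>Z. (norm (c j))\<^sup>2) / H)) ?I" .
  from has_integral_linear[OF this bounded_linear_Re]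
  have "((\<lambda>x. Re (?T x)) has_integral ((\<Sum>j\<in>Z. (norm (c j))\<^sup>2) / H)) ?I"
    unfolding o_def Re_complex_of_real .
  then show ?thesis
    unfolding expand[symmetric] by (simp add: integral_unique)
qed

lemma norm_trig_poly_shift:
  "norm (\<Sum>n\<in>A. c n * unit_exp (v * (F n - t))) = norm (\<Sum>n\<in>A. c n * unit_exp (v * F n))"
proof -
  have "(\<Sum>n\<in>A. c n * unit_exp (v * (F n - t))) = unit_exp (- (v * t)) * (\<Sum>n\<in>A. c n * unit_exp (v * F n))"
    unfolding sum_distrib_left
  proof (intro sum.cong refl)
    fix n
    have "unit_exp (v * (F n - t)) = unit_exp (- (v * t)) * unit_exp (v * F n)"
      using unit_exp_add[of "- (v * t)" "v * F n"] by (simp add: algebra_simps)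
    then show "c n * unit_exp (v * (F n - t)) = unit_exp (- (v * t)) * (c n * unit_exp (v * F n))"
      by simp
  qed
  then show ?thesis by (simp add: norm_mult)
qed

text \<open>On a cell of length \<open>1 / H\<close> the window sums, demodulated by multiples of \<open>H\<close>, are
  essentially constant while their carriers are exactly orthogonal.\<close>

lemma cell_estimates:
  fixes F :: "nat \<Rightarrow> real" and c :: "nat \<Rightarrow> complex" and H R a :: real
  assumes "H > 0" "finite A"
  defines "w \<equiv> (\<lambda>n. \<lfloor>F n / H\<rfloor>)"
  defines "c' \<equiv> (\<lambda>n. of_real (frac (F n / H)) * c n)"
  defines "R \<equiv> integral {a..a + 1 / H} (\<lambda>x. window_square F w A c x + window_square F w A c' x)"
  shows "integral {a..a + 1 / H} (\<lambda>x. (norm (\<Sum>n\<in>A. c n * unit_exp (x * F n)))\<^sup>2) \<le> 80 * R"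
    and "\<And>x. x \<in> {a..a + 1 / H} \<Longrightarrow>
      (norm (\<Sum>n\<in>A. c n * unit_exp (x * F n)))\<^sup>2 \<le> card (w ` A) * (80 * H * R)"
proof -
  define b where "b = a + 1 / H"
  have ab: "a < b" "b - a = 1 / H" using \<open>H > 0\<close> by (auto simp: b_def)
  define P where "P j = {n\<in>A. w n = j}" for j
  define Z where "Z = w ` A"
  have [simp]: "finite Z" "finite (P j)" for j using assms(2) by (auto simp: Z_def P_def)
  \<comment> \<open>\<open>g j\<close> is the window sum with the carrier of frequency
    \<open>H * j\<close> removed. The remaining frequencies are \<open>H * frac (F n / H)\<close>,
    so the derivative of \<open>g j\<close> is \<open>\<kappa> * h j\<close>, with a factor of order
    \<open>H\<close> that the cell length \<open>1 / H\<close> compensates.\<close>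
  define g where "g j v = (\<Sum>n\<in>P j. c n * unit_exp (v * (F n - H * j)))" for j :: int and v
  define h where "h j v = (\<Sum>n\<in>P j. c' n * unit_exp (v * (F n - H * j)))" for j :: int and v
  define Q where "Q = window_square F w A c"
  define Q' where "Q' = window_square F w A c'"
  have Q_eq: "Q v = (\<Sum>j\<in>Z. (norm (g j v))\<^sup>2)" and Q'_eq: "Q' v = (\<Sum>j\<in>Z. (norm (h j v))\<^sup>2)" for v
    unfolding Q_def Q'_def window_square_def g_def h_def norm_trig_poly_shift P_def Z_def by auto
  have int: "Q integrable_on {a..b}" "Q' integrable_on {a..b}"
    unfolding Q_def Q'_def by (intro integrable_continuous_interval continuous_intros)+
  have R_eq: "R = integral {a..b} Q + integral {a..b} Q'"
    unfolding R_def b_def[symmetric] Q_def[symmetric] Q'_def[symmetric]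
    using int by (rule Henstock_Kurzweil_Integration.integral_add)
  define \<kappa> where "\<kappa> = of_real (2 * pi * H) * \<i>"
  have norm_\<kappa>: "(norm (\<kappa> * z))\<^sup>2 = 4 * pi\<^sup>2 * H\<^sup>2 * (norm z)\<^sup>2" for z
    using \<open>H > 0\<close> by (simp add: \<kappa>_def norm_mult power_mult_distrib)
  \<comment> \<open>Source of the constant 80: the derivative term of the Sobolev inequality on a
    cell carries the factor 2 (1 / H) (2 pi H)^2 = 8 pi^2 H.\<close>
  have pi2: "8 * pi\<^sup>2 \<le> 80"
  proof -
    have "pi * pi \<le> 3.15 * 3.15" using pi_approx by (intro mult_mono) auto
    then show ?thesis by (simp add: power2_eq_square)
  qed
  have deriv: "(g j has_vector_derivative \<kappa> * h j v) (at v within S)" for j v S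
  proof -
    have "(g j has_vector_derivative
        (\<Sum>n\<in>P j. c n * (of_real (2 * pi * (F n - H * j)) * \<i> * unit_exp (v * (F n - H * j))))) (at v within S)"
      unfolding g_def
      by (intro has_vector_derivative_sum has_vector_derivative_mult_right has_vector_derivative_unit_exp)
    also have "(\<Sum>n\<in>P j. c n * (of_real (2 * pi * (F n - H * j)) * \<i> * unit_exp (v * (F n - H * j)))) = \<kappa> * h j v"
      unfolding h_def sum_distrib_left
    proof (intro sum.cong refl)
      fix n assume "n \<in> P j"
      then have "F n - H * j = H * frac (F n / H)"
        using \<open>H > 0\<close> by (auto simp: P_def w_def frac_def field_simps)
      then show "c n * (of_real (2 * pi * (F n - H * j)) * \<i> * unit_exp (v * (F n - H * j)))
          = \<kappa> * (c' n * unit_exp (v * (F n - H * j)))"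
        by (simp add: \<kappa>_def c'_def)
    qed
    finally show ?thesis .
  qed
  have cont_h: "continuous_on S (h j)" and cont_g: "continuous_on S (g j)" for S j
    unfolding h_def g_def by (intro continuous_intros)+
  have norm_g: "(norm (g j v))\<^sup>2 \<le> 2 * H * integral {a..b} (\<lambda>v. (norm (g j v))\<^sup>2)
      + 8 * pi\<^sup>2 * H * integral {a..b} (\<lambda>v. (norm (h j v))\<^sup>2)" if "v \<in> {a..b}" for j v
  proof -
    have "(norm (g j v))\<^sup>2 \<le> 2 / (b - a) * integral {a..b} (\<lambda>v. (norm (g j v))\<^sup>2)
        + 2 * (b - a) * integral {a..b} (\<lambda>v. (norm (\<kappa> * h j v))\<^sup>2)"
      by (intro norm_power2_le_Sobolev ab that deriv continuous_intros cont_h)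
    then show ?thesis
      using \<open>H > 0\<close> unfolding norm_\<kappa> ab by (simp add: power2_eq_square)
  qed
  have int_sq: "(\<lambda>v. (norm (g j v))\<^sup>2) integrable_on {a..b}" "(\<lambda>v. (norm (h j v))\<^sup>2) integrable_on {a..b}" for j
    by (intro integrable_continuous_interval continuous_intros cont_g cont_h)+
  have nonneg: "integral {a..b} Q \<ge> 0" "integral {a..b} Q' \<ge> 0"
    using int by (auto intro!: integral_nonneg simp: Q_def Q'_def window_square_nonneg)
  have Q_le: "Q v \<le> 80 * H * R" if "v \<in> {a..b}" for v
  proof -
    have "Q v \<le> (\<Sum>j\<in>Z. 2 * H * integral {a..b} (\<lambda>v. (norm (g j v))\<^sup>2)
      + 8 * pi\<^sup>2 * H * integral {a..b} (\<lambda>v. (norm (h j v))\<^sup>2))"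
      unfolding Q_eq by (intro sum_mono norm_g that)
    also have "\<dots> = 2 * H * integral {a..b} Q + 8 * pi\<^sup>2 * H * integral {a..b} Q'"
      unfolding Q_eq Q'_eq by (simp add: integral_sum int_sq sum.distrib sum_distrib_left)
    also have "\<dots> \<le> 80 * H * integral {a..b} Q + 80 * H * integral {a..b} Q'"
      using \<open>H > 0\<close> nonneg pi2 by (intro add_mono mult_right_mono) auto
    finally show ?thesis by (simp add: R_eq algebra_simps)
  qed
  let ?B = "\<lambda>x. \<Sum>n\<in>A. c n * unit_exp (x * F n)"
  \<comment> \<open>Separates the two scales: the carriers are evaluated at \<open>x\<close> and the
    slowly varying amplitudes at \<open>v\<close>, so the block sum is the diagonal value
    \<open>\<Phi> x x\<close>. The Sobolev inequality is applied in \<open>v\<close> with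
    \<open>x\<close> fixed; after that the integral over \<open>x\<close> sees exactly orthogonal
    carriers.\<close>
  define \<Phi> where "\<Phi> x v = (\<Sum>j\<in>Z. g j v * unit_exp (x * (H * j)))" for x v
  define \<Psi> where "\<Psi> x v = (\<Sum>j\<in>Z. h j v * unit_exp (x * (H * j)))" for x v
  have B_eq: "?B x = \<Phi> x x" for x
  proof -
    have "?B x = (\<Sum>j\<in>Z. \<Sum>n\<in>P j. c n * unit_exp (x * F n))"
      unfolding Z_def P_def by (rule sum.image_gen[OF assms(2)])
    also have "\<dots> = \<Phi> x x"
      unfolding \<Phi>_def g_def sum_distrib_right
    proof (intro sum.cong refl)
      fix j :: int and n
      have "unit_exp (x * F n) = unit_exp (x * (F n - H * j)) * unit_exp (x * (H * j))"
        unfolding unit_exp_add[symmetric] by (simp add: algebra_simps)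
      then show "c n * unit_exp (x * F n) = c n * unit_exp (x * (F n - H * j)) * unit_exp (x * (H * j))"
        by simp
    qed
    finally show ?thesis .
  qed
  have norm_B: "(norm (?B x))\<^sup>2 \<le> 2 * H * integral {a..b} (\<lambda>v. (norm (\<Phi> x v))\<^sup>2)
      + 8 * pi\<^sup>2 * H * integral {a..b} (\<lambda>v. (norm (\<Psi> x v))\<^sup>2)" if "x \<in> {a..b}" for x
  proof -
    have "(norm (\<Phi> x x))\<^sup>2 \<le> 2 / (b - a) * integral {a..b} (\<lambda>v. (norm (\<Phi> x v))\<^sup>2)
        + 2 * (b - a) * integral {a..b} (\<lambda>v. (norm (\<kappa> * \<Psi> x v))\<^sup>2)"
    proof (intro norm_power2_le_Sobolev ab that)
      fix v
      have "(\<Phi> x has_vector_derivative (\<Sum>j\<in>Z. \<kappa> * h j v * unit_exp (x * (H * j)))) (at v within {a..b})"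
        unfolding \<Phi>_def by (intro has_vector_derivative_sum has_vector_derivative_mult_left deriv)
      then show "(\<Phi> x has_vector_derivative \<kappa> * \<Psi> x v) (at v within {a..b})"
        by (simp add: \<Psi>_def sum_distrib_left mult.assoc)
    qed (unfold \<Psi>_def, intro continuous_intros cont_h)
    then show ?thesis
      using \<open>H > 0\<close> unfolding norm_\<kappa> ab B_eq by (simp add: power2_eq_square)
  qed
  \<comment> \<open>After exchanging the integrals, Parseval applies in \<open>x\<close> for each
    fixed \<open>v\<close>.\<close>
  have double: "(\<lambda>x. integral {a..b} (\<lambda>v. (norm (\<Sum>j\<in>Z. k j v * unit_exp (x * (H * j))))\<^sup>2)) integrable_on {a..b}"
       "integral {a..b} (\<lambda>x. integral {a..b} (\<lambda>v. (norm (\<Sum>j\<in>Z. k j v * unit_exp (x * (H * j))))\<^sup>2))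
        = integral {a..b} (\<lambda>v. \<Sum>j\<in>Z. (norm (k j v))\<^sup>2) / H"
    if k: "\<And>S j. continuous_on S (k j)" for k
  proof -
    have cont_k: "continuous_on S (\<lambda>x. k j (u x))" if "continuous_on S u" for S :: "(real \<times> real) set" and j u
      using continuous_on_compose[OF that k] by (simp add: o_def)
    have cont: "continuous_on S (\<lambda>(x, v). (norm (\<Sum>j\<in>Z. k j v * unit_exp (x * (H * j))))\<^sup>2)" for S :: "(real \<times> real) set"
      unfolding case_prod_beta by (intro continuous_intros cont_k)
    show "(\<lambda>x. integral {a..b} (\<lambda>v. (norm (\<Sum>j\<in>Z. k j v * unit_exp (x * (H * j))))\<^sup>2)) integrable_on {a..b}"
      using integral_continuous_on_param[OF cont, of "{a..b}" a b]
      by (simp add: integrable_continuous_interval)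
    have "integral {a..b} (\<lambda>x. integral {a..b} (\<lambda>v. (norm (\<Sum>j\<in>Z. k j v * unit_exp (x * (H * j))))\<^sup>2))
        = integral {a..b} (\<lambda>v. integral {a..b} (\<lambda>x. (norm (\<Sum>j\<in>Z. k j v * unit_exp (x * (H * j))))\<^sup>2))"
      using integral_swap_continuous[OF cont[of "cbox (a, a) (b, b)"]] by simp
    also have "\<dots> = integral {a..b} (\<lambda>v. (\<Sum>j\<in>Z. (norm (k j v))\<^sup>2) / H)"
      unfolding b_def by (simp add: integral_norm_periodic_power2 \<open>H > 0\<close>)
    finally show "integral {a..b} (\<lambda>x. integral {a..b} (\<lambda>v. (norm (\<Sum>j\<in>Z. k j v * unit_exp (x * (H * j))))\<^sup>2))
        = integral {a..b} (\<lambda>v. \<Sum>j\<in>Z. (norm (k j v))\<^sup>2) / H"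
      by simp
  qed
  have "integral {a..b} (\<lambda>x. (norm (?B x))\<^sup>2) \<le> integral {a..b} (\<lambda>x.
      2 * H * integral {a..b} (\<lambda>v. (norm (\<Phi> x v))\<^sup>2) + 8 * pi\<^sup>2 * H * integral {a..b} (\<lambda>v. (norm (\<Psi> x v))\<^sup>2))"
    unfolding \<Phi>_def \<Psi>_def
    by (intro integral_le integrable_add integrable_on_mult_right double cont_g cont_h
        norm_B[unfolded \<Phi>_def \<Psi>_def] integrable_continuous_interval continuous_intros)
  also have "\<dots> = 2 * H * (integral {a..b} Q / H) + 8 * pi\<^sup>2 * H * (integral {a..b} Q' / H)"
    unfolding \<Phi>_def \<Psi>_def Q_eq Q'_eq
    by (subst Henstock_Kurzweil_Integration.integral_add)
       (auto intro!: integrable_on_mult_right double cont_g cont_h simp: double(2)[OF cont_g] double(2)[OF cont_h])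
  also have "\<dots> \<le> 80 * integral {a..b} Q + 80 * integral {a..b} Q'"
    using \<open>H > 0\<close> nonneg mult_right_mono[OF pi2, of "integral {a..b} Q'"] by (simp add: mult_ac)
  finally show "integral {a..a + 1 / H} (\<lambda>x. (norm (?B x))\<^sup>2) \<le> 80 * R"
    by (simp add: R_eq b_def)
  show "(norm (?B x))\<^sup>2 \<le> card (w ` A) * (80 * H * R)" if "x \<in> {a..a + 1 / H}" for x
  proof -
    \<comment> \<open>Pointwise, orthogonality is of no help, and Cauchy-Schwarz over the windows
      costs the factor \<open>card Z\<close>.\<close>
    have "norm (?B x) \<le> (\<Sum>j\<in>Z. norm (g j x))"
      unfolding B_eq \<Phi>_def by (rule order_trans[OF norm_sum]) (simp add: norm_mult)
    then have "(norm (?B x))\<^sup>2 \<le> (\<Sum>j\<in>Z. norm (g j x))\<^sup>2"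
      by (intro power_mono) auto
    also have "\<dots> \<le> card Z * Q x"
      unfolding Q_eq using Cauchy_Schwarz_ineq_sum[of "\<lambda>_. 1" "\<lambda>j. norm (g j x)" Z] by simp
    also have "\<dots> \<le> card Z * (80 * H * R)"
      using Q_le[of x] that by (intro mult_left_mono) (auto simp: b_def)
    finally show ?thesis by (simp add: Z_def)
  qed
qed

section \<open>Counting cells\<close>

lemma integral_equal_cells:
  fixes h :: "real \<Rightarrow> real"
  assumes "r \<ge> 0" "h integrable_on {p..p + real M * r}"
  shows "integral {p..p + real M * r} h = (\<Sum>i<M. integral {p + real i * r..p + real i * r + r} h)"
  using assms(2)
proof (induction M)
  case (Suc M)
  have eq: "p + real (Suc M) * r = p + real M * r + r" by (simp add: algebra_simps)
  have le: "p \<le> p + real M * r" "p + real M * r \<le> p + real (Suc M) * r"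
    using assms(1) unfolding eq by auto
  then have "integral {p..p + real (Suc M) * r} h =
      integral {p..p + real M * r} h + integral {p + real M * r..p + real (Suc M) * r} h"
    using Suc.prems by (intro Henstock_Kurzweil_Integration.integral_combine[symmetric])
  moreover have "h integrable_on {p..p + real M * r}"
    by (rule integrable_on_subinterval[OF Suc.prems]) (use le in auto)
  ultimately show ?case using Suc.IH unfolding eq by simp
qed simp

lemma card_nat_between:
  fixes X :: "nat set"
  assumes "\<And>k. k \<in> X \<Longrightarrow> \<alpha> \<le> real k \<and> real k \<le> \<beta>" and "\<alpha> \<le> \<beta> + 1"
  shows "finite X" "real (card X) \<le> \<beta> - \<alpha> + 1"
proof -
  have "X \<subseteq> {..nat \<lfloor>\<beta>\<rfloor>}" using assms(1) le_nat_floor by blast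
  then show fin: "finite X" using finite_subset by blast
  show "real (card X) \<le> \<beta> - \<alpha> + 1"
  proof (cases "X = {}")
    case False
    have "X \<subseteq> {Min X..Max X}" using fin by auto
    then have "card X \<le> Suc (Max X) - Min X"
      using card_mono[of "{Min X..Max X}" X] by simp
    moreover have "Min X \<in> X" "Max X \<in> X" using fin False by auto
    moreover have "Min X \<le> Max X" using fin False by simp
    ultimately have "real (card X) \<le> real (Max X) - real (Min X) + 1"
      by linarith
    then show ?thesis using assms(1)[OF \<open>Min X \<in> X\<close>] assms(1)[OF \<open>Max X \<in> X\<close>] by linarith
  qed (use assms(2) in simp)
qed

lemma card_grid_cells_meeting:
  fixes p y u \<sigma> :: real
  assumes "\<sigma> > 0" "u \<ge> 0"
    and "\<And>k. k \<in> X \<Longrightarrow> {p + real k * \<sigma>..p + real k * \<sigma> + \<sigma>} \<inter> {y..y + u} \<noteq> {}"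
  shows "finite X" "real (card X) \<le> u / \<sigma> + 2"
proof -
  have bounds: "(y - p) / \<sigma> - 1 \<le> real k \<and> real k \<le> (y + u - p) / \<sigma>" if "k \<in> X" for k
  proof -
    have "p + real k * \<sigma> \<le> y + u" "y \<le> p + real k * \<sigma> + \<sigma>" using assms(3)[OF that] by auto
    then show ?thesis using \<open>\<sigma> > 0\<close> by (simp add: field_simps)
  qed
  have "(y - p) / \<sigma> - 1 \<le> (y + u - p) / \<sigma> + 1"
    using assms(1,2) by (simp add: field_simps)
  note * = card_nat_between[of X, OF bounds this]
  show "finite X" by (rule *(1))
  have "(y + u - p) / \<sigma> - ((y - p) / \<sigma> - 1) + 1 = u / \<sigma> + 2"
    using assms(1) by (simp add: field_simps)
  then show "real (card X) \<le> u / \<sigma> + 2" using *(2) by simp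
qed

text \<open>Grid cells on which \<open>h\<close> stays below \<open>\<alpha>\<close> carry at most
  half of the mass. The other half lies in the remaining cells, and each of these carries at most
  \<open>S * \<tau>\<close>.\<close>

lemma many_large_grid_cells:
  fixes h :: "real \<Rightarrow> real"
  assumes "\<tau> > 0" "\<alpha> \<ge> 0" and cont: "continuous_on {p..p + real L * \<tau>} h"
    and upper: "\<And>x. x \<in> {p..p + real L * \<tau>} \<Longrightarrow> h x \<le> S"
    and mass: "2 * \<alpha> * (real L * \<tau>) \<le> integral {p..p + real L * \<tau>} h"
  shows "\<alpha> * L \<le> S * card {k. k < L \<and> (\<exists>x\<in>{p + real k * \<tau>..p + real k * \<tau> + \<tau>}. \<alpha> \<le> h x)}"
proof -
  define E where "E = {k. k < L \<and> (\<exists>x\<in>{p + real k * \<tau>..p + real k * \<tau> + \<tau>}. \<alpha> \<le> h x)}"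
  have sub: "{p + real k * \<tau>..p + real k * \<tau> + \<tau>} \<subseteq> {p..p + real L * \<tau>}" if "k < L" for k
  proof -
    have "(real k + 1) * \<tau> \<le> real L * \<tau>" using that assms(1) by (intro mult_right_mono) auto
    then have "real k * \<tau> + \<tau> \<le> real L * \<tau>" by (simp add: algebra_simps)
    moreover have "0 \<le> real k * \<tau>" using assms(1) by simp
    ultimately show ?thesis by auto
  qed
  have bound: "integral {p + real k * \<tau>..p + real k * \<tau> + \<tau>} h \<le> C * \<tau>"
    if "k < L" "\<And>x. x \<in> {p + real k * \<tau>..p + real k * \<tau> + \<tau>} \<Longrightarrow> h x \<le> C" for k C
  proof -
    have "integral {p + real k * \<tau>..p + real k * \<tau> + \<tau>} h \<le> integral {p + real k * \<tau>..p + real k * \<tau> + \<tau>} (\<lambda>_. C)"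
      using continuous_on_subset[OF cont sub[OF that(1)]] that(2)
      by (intro integral_le integrable_continuous_interval continuous_intros) auto
    then show ?thesis using assms(1) by (simp add: mult.commute)
  qed
  have "2 * \<alpha> * (real L * \<tau>) \<le> (\<Sum>k<L. integral {p + real k * \<tau>..p + real k * \<tau> + \<tau>} h)"
    using mass integral_equal_cells[of \<tau> h p L] assms(1) integrable_continuous_interval[OF cont] by simp
  also have "\<dots> \<le> (\<Sum>k<L. (if k \<in> E then S * \<tau> else 0) + \<alpha> * \<tau>)"
  proof (rule sum_mono)
    fix k assume "k \<in> {..<L}"
    then have k: "k < L" by simp
    show "integral {p + real k * \<tau>..p + real k * \<tau> + \<tau>} h \<le> (if k \<in> E then S * \<tau> else 0) + \<alpha> * \<tau>"
    proof (cases "k \<in> E")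
      case True
      have "integral {p + real k * \<tau>..p + real k * \<tau> + \<tau>} h \<le> S * \<tau>"
        using upper sub[OF k] by (intro bound k) blast
      then show ?thesis using True assms(1,2) by (simp add: add_increasing2)
    next
      case False
      then have "h x \<le> \<alpha>" if "x \<in> {p + real k * \<tau>..p + real k * \<tau> + \<tau>}" for x
        using k that by (force simp: E_def)
      then show ?thesis using False bound[OF k] by simp
    qed
  qed
  also have "\<dots> = real (card E) * (S * \<tau>) + L * (\<alpha> * \<tau>)"
  proof -
    have "{..<L} \<inter> {k. k \<in> E} = E" by (auto simp: E_def)
    then show ?thesis by (simp add: sum.distrib sum.If_cases)
  qed
  finally have "(\<alpha> * L) * \<tau> \<le> (S * card E) * \<tau>" by (simp add: algebra_simps)
  then show ?thesis using assms(1) unfolding E_def[symmetric] by simp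
qed

text \<open>Here \<open>P i\<close> and \<open>R i\<close> are the integrals of \<open>\<bar>B\<bar>\<^sup>2\<close> and \<open>Q\<close> over the \<open>i\<close>-th cell. Cells with large \<open>R\<close>
  carry little of the mass by the second moment of \<open>R\<close>.\<close>

lemma many_good_cells:
  fixes P R :: "nat \<Rightarrow> real" and n r C :: real
  assumes "n > 0" "r > 0" "C > 0"
    and nonneg: "\<And>i. i < M \<Longrightarrow> 0 \<le> P i"
    and PR: "\<And>i. i < M \<Longrightarrow> P i \<le> 80 * R i"
    and mass: "n / 2 * (M * r) \<le> (\<Sum>i<M. P i)"
    and square: "(\<Sum>i<M. (R i)\<^sup>2) \<le> r * (C * n\<^sup>2 * (M * r))"
  shows "M \<le> 320 * (640 * C) * card {i. i < M \<and> R i \<le> 640 * C * n * r \<and> n * r / 8 \<le> P i}"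
proof -
  define T where "T = 640 * C"
  define G where "G = {i. i < M \<and> R i \<le> T * n * r \<and> n * r / 8 \<le> P i}"
  have T: "T > 0" using assms by (simp add: T_def)
  \<comment> \<open>The three terms majorise good cells, cells with small \<open>P\<close>, and
    cells with large \<open>R\<close>. In the last case \<open>R i\<close> is at most its square
    divided by \<open>T * n * r\<close>, as in Chebyshev's inequality. With
    \<open>T = 640 * C\<close> the third term sums to at most \<open>M * (n * r / 8)\<close>, the
    same as the second, which leaves half of the mass to the good cells.\<close>
  have bound: "P i \<le> (if i \<in> G then 80 * T * n * r else 0) + n * r / 8 + 80 / (T * n * r) * (R i)\<^sup>2" if "i < M" for i
  proof (cases "R i \<le> T * n * r")
    case True
    have pos: "0 \<le> 80 / (T * n * r) * (R i)\<^sup>2" "0 < n * r" using assms T by auto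
    show ?thesis
    proof (cases "i \<in> G")
      case t: True
      have "P i \<le> 80 * T * n * r" using PR[OF that] True by simp
      then show ?thesis using t pos by simp
    next
      case False
      then have "P i \<le> n * r / 8" using True that by (auto simp: G_def)
      then show ?thesis using False pos by simp
    qed
  next
    case False
    then have "1 \<le> R i / (T * n * r)" using assms T by simp
    then have "R i * 1 \<le> R i * (R i / (T * n * r))"
      using PR[OF that] nonneg[OF that] by (intro mult_left_mono) auto
    then have "P i \<le> 80 / (T * n * r) * (R i)\<^sup>2"
      using PR[OF that] by (simp add: power2_eq_square)
    moreover have "0 < n * r" using assms by simp
    ultimately show ?thesis using False by (simp add: G_def)
  qed
  have "n / 2 * (M * r) \<le> (\<Sum>i<M. (if i \<in> G then 80 * T * n * r else 0) + n * r / 8 + 80 / (T * n * r) * (R i)\<^sup>2)"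
    by (rule order_trans[OF mass sum_mono]) (use bound in auto)
  also have "\<dots> = card G * (80 * T * n * r) + M * (n * r / 8) + 80 / (T * n * r) * (\<Sum>i<M. (R i)\<^sup>2)"
  proof -
    have "{..<M} \<inter> {k. k \<in> G} = G" by (auto simp: G_def)
    then show ?thesis by (simp add: sum.distrib sum.If_cases sum_distrib_left)
  qed
  also have "\<dots> \<le> card G * (80 * T * n * r) + M * (n * r / 8) + 80 / (T * n * r) * (r * (C * n\<^sup>2 * (M * r)))"
    using square assms T by (intro add_left_mono mult_left_mono) auto
  also have "80 / (T * n * r) * (r * (C * n\<^sup>2 * (M * r))) = M * (n * r / 8)"
    using assms by (simp add: T_def power2_eq_square field_simps)
  finally have "(n * r) * M \<le> (n * r) * (320 * T * card G)"
    by (simp add: algebra_simps)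
  then have "M \<le> 320 * T * card G"
    using assms by (subst (asm) mult_le_cancel_left_pos) auto
  then show ?thesis by (simp add: G_def T_def mult.assoc)
qed

text \<open>\<open>A\<close> consists of \<open>n0\<close> grid cells of length
  \<open>\<tau>\<close> in each selected coarse cell of length \<open>r\<close>. There are three
  ranges. For \<open>r \<le> u\<close> the interval meets at most 3 u / r coarse cells, and u / l is
  at most its power with exponent \<open>s\<close>. For \<open>v \<le> u < r\<close> it meets at
  most three coarse cells, which \<open>key\<close> pays for. For \<open>u < v\<close> all grid
  cells near the interval are counted, at most 3 u / \<tau>; since
  \<open>v \<le> n0 * \<tau>\<close>, this is at most 3 n0 u / v, and u / v is at most its power
  with exponent \<open>s\<close>.\<close>

lemma grid_count_le:
  fixes \<tau> r v l s C :: real and L M n0 :: nat and A G :: "nat set"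
  assumes "\<tau> > 0" "L > 0" and r: "r = real L * \<tau>"
    and l: "0 < l" and s: "0 < s" "s < 1"
    and A: "finite A" "card A = card G * n0" and G: "real M \<le> C * card G" "C > 0"
    and fibre: "\<And>i. card {k\<in>A. k div L = i} \<le> n0"
    and v: "0 < v" "v \<le> n0 * \<tau>" and Mr: "l \<le> 2 * (M * r)"
    and key: "r \<le> v powr s * l powr (1 - s)"
    and u: "\<tau> \<le> u" "u \<le> l"
  shows "card {k\<in>A. {p + real k * \<tau>..p + real k * \<tau> + \<tau>} \<inter> {y..y + u} \<noteq> {}}
           \<le> 6 * C * card A * (u / l) powr s"
proof -
  define B where "B = {k\<in>A. {p + real k * \<tau>..p + real k * \<tau> + \<tau>} \<inter> {y..y + u} \<noteq> {}}"
  define X where "X = (\<lambda>k. k div L) ` B"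
  have r_pos: "r > 0" using assms by simp
  have u_pos: "u > 0" using assms by simp
  have finB: "finite B" using A by (simp add: B_def)
  \<comment> \<open>The selected coarse cells form a proportion at least \<open>1 / C\<close> of all
    \<open>M\<close>, and these fill at least half of the length \<open>l\<close>. It is therefore
    enough to bound the count by a multiple of \<open>l * n0 / r\<close>.\<close>
  have cardA: "l * n0 / r \<le> 2 * C * card A"
  proof -
    have "l / r \<le> 2 * M" using Mr r_pos by (simp add: field_simps)
    also have "\<dots> \<le> 2 * (C * card G)" using G by simp
    finally have "l / r * n0 \<le> 2 * (C * card G) * n0" by (intro mult_right_mono) auto
    then show ?thesis using A by (simp add: mult_ac)
  qed
  have cell_sub: "{p + real k * \<tau>..p + real k * \<tau> + \<tau>} \<subseteq> {p + real (k div L) * r..p + real (k div L) * r + r}" for k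
  proof -
    have k: "real k = real (k div L) * real L + real (k mod L)"
      by (metis div_mult_mod_eq of_nat_add of_nat_mult)
    have "real (k mod L) + 1 \<le> real L"
      using \<open>L > 0\<close> mod_less_divisor[of L k] by linarith
    then have "(real k + 1) * \<tau> \<le> (real (k div L) * real L + real L) * \<tau>"
      using assms(1) k by (intro mult_right_mono) auto
    moreover have "real (k div L) * real L * \<tau> \<le> real k * \<tau>"
      using assms(1) k by (intro mult_right_mono) auto
    ultimately show ?thesis by (auto simp: r algebra_simps)
  qed
  have "{p + real i * r..p + real i * r + r} \<inter> {y..y + u} \<noteq> {}" if "i \<in> X" for i
    using that cell_sub unfolding X_def B_def by fast
  note X = card_grid_cells_meeting[of r u X, OF r_pos less_imp_le[OF u_pos] this]
  have "B = (\<Union>i\<in>X. {k\<in>B. k div L = i})" by (auto simp: X_def)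
  then have "card B \<le> (\<Sum>i\<in>X. card {k\<in>B. k div L = i})"
    using card_UN_le[of X, OF X(1), where A = "\<lambda>i. {k\<in>B. k div L = i}"] by simp
  also have "\<dots> \<le> (\<Sum>i\<in>X. n0)"
  proof (rule sum_mono)
    fix i
    have "card {k\<in>B. k div L = i} \<le> card {k\<in>A. k div L = i}"
      using A by (intro card_mono) (auto simp: B_def)
    then show "card {k\<in>B. k div L = i} \<le> n0" using fibre[of i] by simp
  qed
  finally have "real (card B) \<le> real (card X * n0)" by (simp del: of_nat_mult)
  also have "\<dots> = real (card X) * n0" by simp
  also have "\<dots> \<le> (u / r + 2) * n0"
    using X(2) by (intro mult_right_mono) auto
  finally have B1: "real (card B) \<le> (u / r + 2) * n0" .
  have "real (card B) \<le> u / \<tau> + 2"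
    using card_grid_cells_meeting(2)[OF assms(1) less_imp_le[OF u_pos], of B p y] by (auto simp: B_def)
  also have "\<dots> \<le> 3 * u / \<tau>" using u assms(1) by (simp add: field_simps)
  finally have B2: "real (card B) \<le> 3 * u / \<tau>" .
  have target: "real (card B) \<le> 6 * C * card A * (u / l) powr s"
    if "real (card B) \<le> 3 * (l * n0 / r) * (u / l) powr s"
  proof -
    have "3 * (l * n0 / r) * (u / l) powr s \<le> 3 * (2 * C * card A) * (u / l) powr s"
      using cardA by (intro mult_right_mono) auto
    then show ?thesis using that by simp
  qed
  have "real (card B) \<le> 3 * (l * n0 / r) * (u / l) powr s"
  proof (cases "r \<le> u")
    case True
    have "u / r + 2 \<le> 3 * (u / r)" using True r_pos by (simp add: field_simps)
    from mult_right_mono[OF this, of "real n0"] have "real (card B) \<le> (3 * (u / r)) * n0"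
      using B1 by linarith
    also have "\<dots> = 3 * (l * n0 / r) * (u / l)" using l by simp
    also have "\<dots> \<le> 3 * (l * n0 / r) * (u / l) powr s"
    proof (rule mult_left_mono)
      have "(u / l) powr 1 \<le> (u / l) powr s"
        using u l u_pos s by (intro powr_mono') auto
      then show "u / l \<le> (u / l) powr s" using u_pos l by simp
    qed (use l r_pos in auto)
    finally show ?thesis .
  next
    case False
    \<comment> \<open>\<open>key\<close> in scale-free form: it is the desired power law at
      \<open>u = v\<close>, the critical scale.\<close>
    have key': "r \<le> l * (v / l) powr s"
      using key l v by (simp add: powr_divide powr_diff mult.commute)
    show ?thesis
    proof (cases "v \<le> u")
      case True
      have "u / r + 2 \<le> 3" using \<open>\<not> r \<le> u\<close> r_pos by (simp add: field_simps)
      from mult_right_mono[OF this, of "real n0"] have B3: "real (card B) \<le> 3 * n0"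
        using B1 by linarith
      have "1 \<le> l * (u / l) powr s / r"
      proof -
        have "(v / l) powr s \<le> (u / l) powr s"
          using True v l s by (intro powr_mono2 divide_right_mono) auto
        then have "r \<le> l * (u / l) powr s"
          using key' mult_left_mono[of "(v / l) powr s" "(u / l) powr s" l] l by linarith
        then show ?thesis using r_pos by simp
      qed
      then have "3 * real n0 \<le> 3 * n0 * (l * (u / l) powr s / r)"
        using mult_left_mono[of 1 "l * (u / l) powr s / r" "3 * real n0"] by simp
      also have "\<dots> = 3 * (l * n0 / r) * (u / l) powr s" by simp
      finally show ?thesis using B3 by linarith
    next
      case False
      have "u / \<tau> \<le> u / v * n0"
        using v u_pos assms(1) by (simp add: field_simps)
      moreover have "u / v \<le> l * (u / l) powr s / r"
      proof -
        have "u / v = (u / v) powr s * (u / v) powr (1 - s)"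
          using u_pos v by (simp add: powr_add[symmetric])
        also have "\<dots> \<le> (u / v) powr s * 1"
          using False u_pos v s by (intro mult_left_mono powr_le1) auto
        finally have "r * (u / v) \<le> (l * (v / l) powr s) * (u / v) powr s"
          using key' r_pos u_pos v by (intro mult_mono) auto
        also have "\<dots> = l * (u / l) powr s"
          using l v u_pos by (simp add: powr_divide)
        finally show ?thesis using r_pos by (simp add: field_simps)
      qed
      then have "u / v * n0 \<le> l * (u / l) powr s / r * n0"
        by (intro mult_right_mono) auto
      ultimately have "3 * u / \<tau> \<le> 3 * (l * (u / l) powr s / r * n0)" by linarith
      then show ?thesis using B2 by (simp add: mult_ac)
    qed
  qed
  from target[OF this] show ?thesis by (simp add: B_def)
qed

section \<open>Large block sums\<close>

text \<open>The constants: \<open>43520 = 8 \<cdot> 80 \<cdot> 68\<close> bounds \<open>Q / N\<close> on good cells, where \<open>68 = 4 \<cdot> 17\<close>; the proportion of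
  good cells is at least \<open>1 / 13926400\<close> with \<open>13926400 = 320 \<cdot> 43520\<close>; finally
  \<open>83558400 = 6 \<cdot> 13926400\<close> and \<open>167116800 = 3 \<cdot> 16 \<cdot> 80 \<cdot> 43520\<close>.\<close>

lemma block_step:
  fixes F :: "nat \<Rightarrow> real" and c :: "nat \<Rightarrow> complex" and p l D D' g s :: real and N :: nat
  assumes N: "N \<ge> 1" and l: "0 < l" and s: "0 < s" "s < 1" and g: "g > 0"
    and coeff: "\<And>n. n \<in> {N<..2 * N} \<Longrightarrow> norm (c n) = 1"
    and growth: "\<And>n m. N < n \<Longrightarrow> n < m \<Longrightarrow> m \<le> 2 * N \<Longrightarrow> D * (real m - real n) \<le> F m - F n"
    and range: "F (2 * N) - F (N + 1) \<le> D' * N"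
    and convex: "\<And>y y' d. N < y \<Longrightarrow> y < y' \<Longrightarrow> 1 \<le> d \<Longrightarrow> y' + d \<le> 2 * N \<Longrightarrow>
        (F (y' + d) - F y') - (F (y + d) - F y) \<ge> g * (real y' - real y)"
    and DD': "D \<le> D'" and D_large: "4 * N \<le> D * l" and harm: "4 * harm N \<le> g * (l / 2)"
    and l1: "l \<le> 1"
    and key: "1 / (D * sqrt N) \<le> (1 / (167116800 * D' * N)) powr s * l powr (1 - s)"
  shows "\<exists>\<tau> A. 0 < \<tau> \<and> \<tau> \<le> l \<and> finite A \<and> (\<forall>k\<in>A. real k * \<tau> + \<tau> \<le> l) \<and>
    (\<forall>k\<in>A. \<forall>x\<in>{p + real k * \<tau>..p + real k * \<tau> + \<tau>}.
       49 / 200 * sqrt N \<le> norm (\<Sum>n\<in>{N<..2 * N}. c n * unit_exp (x * F n))) \<and>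
    2 * l powr s \<le> card A * \<tau> powr s \<and>
    (\<forall>y u. \<tau> \<le> u \<longrightarrow> u \<le> l \<longrightarrow>
       card {k\<in>A. {p + real k * \<tau>..p + real k * \<tau> + \<tau>} \<inter> {y..y + u} \<noteq> {}}
         \<le> 83558400 * real (card A) * (u / l) powr s)"
proof -
  define A0 where "A0 = {N<..2 * N}"
  have A0 [simp]: "finite A0" "card A0 = N" by (simp_all add: A0_def)
  have sqrtN: "sqrt N \<ge> 1" using N by simp
  have sqrtN2: "sqrt N * sqrt N = N" by simp
  have D: "D > 0"
  proof -
    have "0 < D * l" using D_large N by (meson less_le_trans of_nat_0_less_iff mult_pos_pos zero_less_numeral less_one less_le_not_le not_less)
    then show ?thesis using l by (simp add: zero_less_mult_iff)
  qed
  \<comment> \<open>Consecutive values of \<open>F\<close> differ by at least \<open>D\<close>, so a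
    window of width \<open>H\<close> spans indices at most \<open>sqrt N\<close> apart. The matching
    cells have length \<open>r = 1 / H\<close>.\<close>
  define H where "H = D * sqrt N"
  define r where "r = 1 / H"
  have H: "H > 0" unfolding H_def using D sqrtN by (intro mult_pos_pos) auto
  have r: "r > 0" "H * r = 1" using H by (auto simp: r_def)
  \<comment> \<open>The number of whole cells that fit into the interval; since \<open>l * H\<close>
    is at least 4, they cover at least half of it.\<close>
  define M where "M = nat \<lfloor>l * H\<rfloor>"
  have lH: "l * H \<ge> 4"
  proof -
    have "4 * 1 \<le> (4 * real N) * sqrt N" using N sqrtN by (intro mult_mono) auto
    also have "\<dots> \<le> (D * l) * sqrt N" using D_large sqrtN by (intro mult_right_mono) auto
    finally show ?thesis by (simp add: H_def mult_ac)
  qed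
  have M: "real M \<le> l * H" "l * H \<le> 2 * real M"
    unfolding M_def using lH by linarith+
  have Mr: "M * r \<le> l" "l \<le> 2 * (M * r)"
    using M H by (simp_all add: r_def field_simps)
  define B where "B x = (\<Sum>n\<in>A0. c n * unit_exp (x * F n))" for x
  have cont_B: "continuous_on S B" for S
    unfolding B_def by (intro continuous_intros)
  define w where "w n = \<lfloor>F n / H\<rfloor>" for n
  define c' where "c' n = of_real (frac (F n / H)) * c n" for n
  define Q where "Q = window_square F w A0 c"
  define Q' where "Q' = window_square F w A0 c'"
  have cont_Q: "continuous_on S Q" "continuous_on S Q'" for S
    unfolding Q_def Q'_def by (intro continuous_intros)+
  define P where "P i = integral {p + real i * r..p + real i * r + r} (\<lambda>x. (norm (B x))\<^sup>2)" for i
  define R where "R i = integral {p + real i * r..p + real i * r + r} (\<lambda>x. Q x + Q' x)" for i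
  define W where "W = card (w ` A0)"
  have w_def': "w = (\<lambda>n. \<lfloor>F n / H\<rfloor>)" and c'_def': "c' = (\<lambda>n. of_real (frac (F n / H)) * c n)"
    by (auto simp: w_def c'_def)
  have PR: "P i \<le> 80 * R i" for i
    using cell_estimates(1)[where H = H and A = A0 and a = "p + real i * r" and c = c and F = F] H
    unfolding P_def R_def B_def Q_def Q'_def w_def'[symmetric] c'_def'[symmetric] r_def by simp
  have sup_B: "(norm (B x))\<^sup>2 \<le> W * (80 * H * R i)" if "x \<in> {p + real i * r..p + real i * r + r}" for x i
    using cell_estimates(2)[where H = H and A = A0 and a = "p + real i * r" and c = c and F = F and x = x] H that
    unfolding R_def B_def Q_def Q'_def w_def'[symmetric] c'_def'[symmetric] r_def W_def by simp
  have P_nonneg: "0 \<le> P i" for i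
    unfolding P_def by (intro integral_nonneg integrable_continuous_interval continuous_intros cont_B) auto
  have l0: "0 < M * r" using Mr l by linarith

  \<comment> \<open>Mean values over the cells and the choice of good cells\<close>
  have mass: "N / 2 * (M * r) \<le> (\<Sum>i<M. P i)"
  proof -
    have "D * l \<le> D * (2 * (M * r))" using Mr D by (intro mult_left_mono) auto
    then have "2 * N \<le> D * (M * r)" using D_large by simp
    moreover have "D \<le> \<bar>F n - F m\<bar>" if "n \<in> A0" "m \<in> A0" "n \<noteq> m" for n m
    proof -
      have *: "D \<le> F m - F n" if "n \<in> A0" "m \<in> A0" "n < m" for n m
      proof -
        have "D * 1 \<le> D * (real m - real n)" using D that by (intro mult_left_mono) auto
        also have "\<dots> \<le> F m - F n" using that by (intro growth) (auto simp: A0_def)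
        finally show ?thesis by simp
      qed
      from *[of n m] *[of m n] that show ?thesis by linarith
    qed
    ultimately have "N / 2 * (M * r) \<le> integral {p..p + M * r} (\<lambda>x. (norm (B x))\<^sup>2)"
      using integral_norm_trig_poly_power2_ge[where a = p and b = "p + M * r" and D = D and A = A0 and c = c and F = F] D l0 coeff
      unfolding B_def by (simp add: A0_def[symmetric])
    also have "\<dots> = (\<Sum>i<M. P i)"
      unfolding P_def using r
      by (intro integral_equal_cells integrable_continuous_interval continuous_intros cont_B) auto
    finally show ?thesis .
  qed
  \<comment> \<open>Cauchy-Schwarz on each cell, then
    \<open>(Q + Q')\<^sup>2 \<le> 2 * Q\<^sup>2 + 2 * Q'\<^sup>2\<close>. The second moment bound
    with constant 17 holds for both coefficient sequences and yields 68.\<close>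
  have square: "(\<Sum>i<M. (R i)\<^sup>2) \<le> r * (68 * (real N)\<^sup>2 * (M * r))"
  proof -
    have "(R i)\<^sup>2 \<le> r * integral {p + real i * r..p + real i * r + r} (\<lambda>x. (Q x + Q' x)\<^sup>2)" for i
      using integral_power2_le[of "p + real i * r" "p + real i * r + r" "\<lambda>x. Q x + Q' x"] r cont_Q
      unfolding R_def by (simp add: continuous_on_add)
    then have "(\<Sum>i<M. (R i)\<^sup>2) \<le> (\<Sum>i<M. r * integral {p + real i * r..p + real i * r + r} (\<lambda>x. (Q x + Q' x)\<^sup>2))"
      by (intro sum_mono)
    also have "\<dots> = r * integral {p..p + M * r} (\<lambda>x. (Q x + Q' x)\<^sup>2)"
      unfolding sum_distrib_left[symmetric] using r
      by (subst integral_equal_cells)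
         (auto intro!: integrable_continuous_interval continuous_intros cont_Q)
    also have "\<dots> \<le> r * (68 * (real N)\<^sup>2 * (M * r))"
    proof (rule mult_left_mono)
      have near: "real m - real n \<le> sqrt N" if "n \<in> A0" "m \<in> A0" "w n = w m" for n m
      proof (cases "n < m")
        case True
        have "D * (real m - real n) \<le> F m - F n"
          using True that by (intro growth) (auto simp: A0_def)
        also have "\<dots> \<le> H"
        proof -
          have "F m / H < F n / H + 1" using that(3) unfolding w_def by linarith
          then show ?thesis using H by (simp add: field_simps)
        qed
        finally show ?thesis using D by (simp add: H_def)
      next
        case False
        then have "real m - real n \<le> 0" by simp
        then show ?thesis using sqrtN by linarith
      qed
      have h: "4 * harm N \<le> g * (p + M * r - p)"
      proof -
        have "g * l \<le> g * (2 * (M * r))" by (rule mult_left_mono[OF Mr(2)]) (use g in simp)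
        moreover have "g * (l / 2) = g * l / 2" "g * (2 * (M * r)) = 2 * (g * (p + M * r - p))" by simp_all
        ultimately show ?thesis using harm by linarith
      qed
      have Q2: "integral {p..p + M * r} (\<lambda>x. (window_square F w A0 b x)\<^sup>2) \<le> 17 * (real N)\<^sup>2 * (M * r)"
        if "\<And>n. n \<in> A0 \<Longrightarrow> norm (b n) \<le> 1" for b
        using integral_window_square_power2_le[where a = p and b = "p + M * r" and g = g and N = N and c = b and w = w and F = F] l0 g that near convex h
        unfolding A0_def by simp
      have c1: "norm (c n) \<le> 1" if "n \<in> A0" for n
        using coeff[of n] that by (simp add: A0_def)
      have c'1: "norm (c' n) \<le> 1" if "n \<in> A0" for n
        using coeff[of n] that frac_lt_1[of "F n / H"] by (simp add: c'_def norm_mult A0_def less_imp_le)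
      have *: "integral {p..p + M * r} (\<lambda>x. (Q x)\<^sup>2) \<le> 17 * (real N)\<^sup>2 * (M * r)"
           "integral {p..p + M * r} (\<lambda>x. (Q' x)\<^sup>2) \<le> 17 * (real N)\<^sup>2 * (M * r)"
        unfolding Q_def Q'_def by (rule Q2, erule c1) (rule Q2, erule c'1)
      have "integral {p..p + M * r} (\<lambda>x. (Q x + Q' x)\<^sup>2) \<le> integral {p..p + M * r} (\<lambda>x. 2 * (Q x)\<^sup>2 + 2 * (Q' x)\<^sup>2)"
      proof (intro integral_le integrable_continuous_interval continuous_intros cont_Q)
        fix x show "(Q x + Q' x)\<^sup>2 \<le> 2 * (Q x)\<^sup>2 + 2 * (Q' x)\<^sup>2"
          using sum_squares_bound[of "Q x" "Q' x"] by (simp add: power2_sum)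
      qed
      also have "\<dots> = 2 * integral {p..p + M * r} (\<lambda>x. (Q x)\<^sup>2) + 2 * integral {p..p + M * r} (\<lambda>x. (Q' x)\<^sup>2)"
        by (subst Henstock_Kurzweil_Integration.integral_add)
           (auto intro!: integrable_continuous_interval continuous_intros cont_Q)
      finally show "integral {p..p + M * r} (\<lambda>x. (Q x + Q' x)\<^sup>2) \<le> 68 * (real N)\<^sup>2 * (M * r)"
        using * by simp
    qed (use r in simp)
    finally show ?thesis .
  qed
  define G where "G = {i. i < M \<and> R i \<le> 43520 * N * r \<and> N * r / 8 \<le> P i}"
  have cardG: "real M \<le> 13926400 * real (card G)"
    using many_good_cells[where n = N and r = r and C = 68 and M = M and P = P and R = R, OF _ r(1) _ P_nonneg PR mass square] N
    unfolding G_def by simp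
  have "finite G" by (simp add: G_def)
  \<comment> \<open>The range of \<open>F\<close> over the block divided by \<open>H\<close>, plus 2
    for the rounding at the two ends. The 2 is absorbed because \<open>D' * sqrt N / D\<close> is at
    least 1, which turns 1 into 3.\<close>
  have W_le: "real W \<le> 3 * D' * sqrt N / D"
  proof -
    have mono: "F n \<le> F m" if "N < n" "n \<le> m" "m \<le> 2 * N" for n m
    proof (cases "n = m")
      case False
      then have "D * (real m - real n) \<le> F m - F n" using that by (intro growth) auto
      moreover have "0 \<le> D * (real m - real n)" using that D by auto
      ultimately show ?thesis by linarith
    qed simp
    have "w ` A0 \<subseteq> {w (N + 1)..w (2 * N)}"
    proof
      fix j assume "j \<in> w ` A0"
      then obtain n where n: "j = w n" "N + 1 \<le> n" "n \<le> 2 * N" by (auto simp: A0_def)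
      then have "F (N + 1) / H \<le> F n / H" "F n / H \<le> F (2 * N) / H"
        using mono[of "N + 1" n] mono[of n "2 * N"] H by (auto intro!: divide_right_mono)
      then show "j \<in> {w (N + 1)..w (2 * N)}" unfolding n(1) w_def by (auto intro: floor_mono)
    qed
    then have "W \<le> card {w (N + 1)..w (2 * N)}"
      unfolding W_def by (intro card_mono) auto
    moreover have "w (N + 1) \<le> w (2 * N)"
      unfolding w_def using mono[of "N + 1" "2 * N"] N H by (intro floor_mono divide_right_mono) auto
    ultimately have "real W \<le> w (2 * N) - w (N + 1) + 1" by simp
    also have "\<dots> \<le> F (2 * N) / H - F (N + 1) / H + 2" unfolding w_def by linarith
    also have "\<dots> = (F (2 * N) - F (N + 1)) / H + 2" by (simp add: diff_divide_distrib)
    also have "\<dots> \<le> D' * N / H + 2" using range H by (intro add_right_mono divide_right_mono) auto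
    also have "D' * N / H = D' * sqrt N / D"
      using D sqrtN unfolding H_def by (simp add: field_simps)
    also have "2 \<le> 2 * (D' * sqrt N / D)"
    proof -
      have "D * 1 \<le> D' * sqrt N" using DD' D sqrtN by (intro mult_mono) auto
      then show ?thesis using D by (simp add: field_simps)
    qed
    finally show ?thesis by simp
  qed
  have W: "W \<ge> 1"
  proof -
    have "A0 \<noteq> {}" using N by (auto simp: A0_def)
    then show ?thesis unfolding W_def by (simp add: Suc_le_eq card_gt_0_iff)
  qed
  \<comment> \<open>An upper bound for the squared block sum on every good cell: the supremum
    estimate for a cell combined with the bound on \<open>R i\<close> and
    \<open>H * r = 1\<close>.\<close>
  define S where "S = W * (80 * 43520 * real N)"
  have S: "S > 0" using W N by (simp add: S_def)
  have B_le_S: "(norm (B x))\<^sup>2 \<le> S" if "i \<in> G" "x \<in> {p + real i * r..p + real i * r + r}" for i x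
  proof -
    have "(norm (B x))\<^sup>2 \<le> W * (80 * H * R i)" by (rule sup_B[OF that(2)])
    also have "\<dots> \<le> W * (80 * H * (43520 * N * r))"
      using that(1) H by (intro mult_left_mono) (auto simp: G_def)
    also have "\<dots> = W * (80 * 43520 * N) * (H * r)" by simp
    finally show ?thesis by (simp add: S_def r)
  qed

  \<comment> \<open>A fine grid inside the good cells\<close>
  define v where "v = 1 / (167116800 * D' * N)"
  have v: "v > 0" using D DD' N by (simp add: v_def)
  \<comment> \<open>Grid cells shorter than \<open>\<delta>\<close> lose at most
    \<open>sqrt N / 200\<close> from the value \<open>sqrt N / 4\<close> attained at one of their
    points, which leaves 49 / 200.\<close>
  obtain \<delta> where \<delta>: "\<delta> > 0" "\<And>x x'. x \<in> {p..p + l} \<Longrightarrow> x' \<in> {p..p + l} \<Longrightarrow> \<bar>x' - x\<bar> < \<delta> \<Longrightarrow> norm (B x' - B x) < 1 / 200 * sqrt N"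
  proof -
    have "uniformly_continuous_on {p..p + l} B"
      by (intro compact_uniformly_continuous cont_B compact_Icc)
    moreover have "0 < 1 / 200 * sqrt N" using N by simp
    ultimately show ?thesis using that unfolding uniformly_continuous_on_def dist_norm real_norm_def by meson
  qed
  \<comment> \<open>Chosen so that \<open>\<tau> powr (1 - s) \<le> q\<close> forces the mass
    condition \<open>2 * l powr s \<le> card A * \<tau> powr s\<close>. Since \<open>s < 1\<close>,
    refining the grid at fixed total length makes this mass grow without bound.\<close>
  define q where "q = l * v / (4 * r * 13926400 * l powr s)"
  have q: "q > 0" using l v r by (simp add: q_def)
  define \<epsilon> where "\<epsilon> = min \<delta> (q powr (1 / (1 - s)))"
  have \<epsilon>: "\<epsilon> > 0" using \<delta> q by (simp add: \<epsilon>_def)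
  obtain L :: nat where L: "r / \<epsilon> < real L" using reals_Archimedean2 by blast
  have L0: "L > 0"
  proof (rule ccontr)
    assume "\<not> L > 0"
    then have "r / \<epsilon> < 0" using L by simp
    moreover have "r / \<epsilon> > 0" using r \<epsilon> by simp
    ultimately show False by linarith
  qed
  define \<tau> where "\<tau> = r / L"
  have \<tau>: "\<tau> > 0" "r = real L * \<tau>" using r L0 by (auto simp: \<tau>_def)
  have "\<tau> < \<epsilon>" using L \<epsilon> L0 by (simp add: \<tau>_def field_simps)
  then have \<tau>\<delta>: "\<tau> < \<delta>" and \<tau>q: "\<tau> powr (1 - s) \<le> q"
  proof -
    assume "\<tau> < \<epsilon>"
    then show "\<tau> < \<delta>" by (simp add: \<epsilon>_def)
    have "\<tau> powr (1 - s) \<le> (q powr (1 / (1 - s))) powr (1 - s)"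
      using \<open>\<tau> < \<epsilon>\<close> \<tau> s by (intro powr_mono2) (auto simp: \<epsilon>_def)
    then show "\<tau> powr (1 - s) \<le> q" using s q by (simp add: powr_powr)
  qed
  \<comment> \<open>The number of grid cells needed for a total length of at least \<open>v\<close>.
    Such a number is available in every good cell: by \<open>LE\<close> the large ones form a
    proportion at least 1 / (55705600 W) of its \<open>L\<close> grid cells, with 55705600 = 16 * 80
    * 43520, and \<open>W_le\<close> turns this proportion of \<open>r\<close> into
    \<open>v\<close>.\<close>
  define n0 where "n0 = nat \<lceil>v / \<tau>\<rceil>"
  have v_n0: "v \<le> n0 * \<tau>"
  proof -
    have "v / \<tau> \<le> n0" unfolding n0_def by linarith
    then show ?thesis using \<tau> by (simp add: field_simps)
  qed
  \<comment> \<open>A good cell has mean square at least \<open>N / 8\<close>; the threshold is half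
    of that, as required by \<open>many_large_grid_cells\<close>.\<close>
  define E where "E i = {k. k < L \<and> (\<exists>x\<in>{p + real i * r + real k * \<tau>..p + real i * r + real k * \<tau> + \<tau>}. N / 16 \<le> (norm (B x))\<^sup>2)}" for i
  have n0_le: "n0 \<le> card (E i)" if "i \<in> G" for i
  proof -
    have mass_i: "2 * (N / 16) * (real L * \<tau>) \<le> integral {p + real i * r..p + real i * r + real L * \<tau>} (\<lambda>x. (norm (B x))\<^sup>2)"
      using that unfolding \<tau>(2)[symmetric] G_def P_def by simp
    have "real N / 16 * L \<le> S * card (E i)"
      unfolding E_def
      by (rule many_large_grid_cells[OF \<tau>(1) _ _ _ mass_i])
         (use B_le_S[OF that] in \<open>auto intro!: continuous_intros cont_B simp: \<tau>(2)[symmetric]\<close>)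
    then have "real N * real L \<le> real N * (real W * 55705600 * real (card (E i)))"
      by (simp add: S_def mult_ac)
    then have LE: "real L \<le> real W * 55705600 * real (card (E i))"
      by (rule mult_left_le_imp_le) (use N in simp)
    have "v / \<tau> = (L * D * sqrt N) / (167116800 * D' * N)"
      using L0 H by (simp add: v_def \<tau>_def r_def H_def)
    also have "\<dots> = (L * D) / (167116800 * D' * sqrt N)"
    proof -
      have "(L * D * t) / (167116800 * D' * (t * t)) = (L * D) / (167116800 * D' * t)" if "t > 0" for t
        using that by simp
      from this[of "sqrt N"] show ?thesis using N by (simp only: sqrtN2) simp
    qed
    also have "\<dots> \<le> (real W * 55705600 * real (card (E i)) * D) / (167116800 * D' * sqrt N)"
      using LE D DD' by (intro divide_right_mono mult_right_mono) auto
    also have "\<dots> = W * (D / (3 * D' * sqrt N)) * card (E i)"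
      by (simp add: mult_ac)
    also have "\<dots> \<le> 1 * real (card (E i))"
    proof (rule mult_right_mono)
      have "W * (D / (3 * D' * sqrt N)) \<le> (3 * D' * sqrt N / D) * (D / (3 * D' * sqrt N))"
        using W_le D DD' by (intro mult_right_mono) auto
      also have "\<dots> = 1" using D DD' N by simp
      finally show "W * (D / (3 * D' * sqrt N)) \<le> 1" .
    qed simp
    finally show ?thesis unfolding n0_def by linarith
  qed
  \<comment> \<open>Each good cell keeps exactly \<open>n0\<close> grid cells, so that none is
    overpopulated and the counting bound is uniform.\<close>
  have "\<exists>X. X \<subseteq> E i \<and> card X = n0" if "i \<in> G" for i
    using obtain_subset_with_card_n[OF n0_le[OF that]] by metis
  then obtain X where X: "\<And>i. i \<in> G \<Longrightarrow> X i \<subseteq> E i" "\<And>i. i \<in> G \<Longrightarrow> card (X i) = n0"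
    by metis
  have XL: "k < L" if "i \<in> G" "k \<in> X i" for i k using X(1)[OF that(1)] that(2) by (auto simp: E_def)
  have finX: "finite (X i)" if "i \<in> G" for i
    using XL[OF that] finite_subset[of "X i" "{..<L}"] by auto
  have divL: "(i * L + k) div L = i" if "k < L" for i k
    using that L0 by simp
  \<comment> \<open>The pair of a coarse index \<open>i\<close> and a position \<open>k < L\<close>
    is coded as an index on the global grid of mesh \<open>\<tau>\<close>; division by
    \<open>L\<close> recovers \<open>i\<close>.\<close>
  define A where "A = (\<lambda>(i, k). i * L + k) ` (SIGMA i:G. X i)"
  have inj: "inj_on (\<lambda>(i, k). i * L + k) (SIGMA i:G. X i)"
  proof (rule inj_onI, clarify)
    fix i k i' k' assume *: "i \<in> G" "k \<in> X i" "i' \<in> G" "k' \<in> X i'" "i * L + k = i' * L + k'"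
    have "i = i'" using divL[OF XL[OF *(1,2)], of i] divL[OF XL[OF *(3,4)], of i'] *(5) by simp
    then show "i = i' \<and> k = k'" using *(5) by simp
  qed
  have finA: "finite A" unfolding A_def using \<open>finite G\<close> finX by auto
  have cardA: "card A = card G * n0"
    unfolding A_def card_image[OF inj] using \<open>finite G\<close> finX X(2) by simp
  have A_cell: "\<exists>i k'. i \<in> G \<and> k' \<in> X i \<and> k = i * L + k' \<and> k' < L \<and> p + real k * \<tau> = p + real i * r + real k' * \<tau>" if "k \<in> A" for k
  proof -
    obtain i k' where "i \<in> G" "k' \<in> X i" "k = i * L + k'" using \<open>k \<in> A\<close> by (auto simp: A_def)
    then show ?thesis using XL by (intro exI[of _ i] exI[of _ k']) (auto simp: \<tau>(2) algebra_simps)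
  qed
  have A_fibre: "k div L \<in> G \<and> k \<in> (\<lambda>k'. k div L * L + k') ` X (k div L)" if "k \<in> A" for k
  proof -
    obtain i k' where *: "i \<in> G" "k' \<in> X i" "k = i * L + k'" "k' < L"
      using A_cell[OF \<open>k \<in> A\<close>] by blast
    have "k div L = i" using divL[OF *(4), of i] *(3) by simp
    then show ?thesis using * by simp
  qed
  have fibre: "card {k\<in>A. k div L = i} \<le> n0" for i
  proof (cases "i \<in> G")
    case True
    have "{k\<in>A. k div L = i} \<subseteq> (\<lambda>k. i * L + k) ` X i"
      using A_fibre by blast
    then have "card {k\<in>A. k div L = i} \<le> card ((\<lambda>k. i * L + k) ` X i)"
      using finX[OF True] by (intro card_mono) auto
    also have "\<dots> \<le> card (X i)" by (rule card_image_le[OF finX[OF True]])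
    finally show ?thesis using X(2)[OF True] by simp
  next
    case False
    have "{k\<in>A. k div L = i} = {}" using A_fibre False by blast
    then show ?thesis by (simp only: card.empty le0)
  qed
  have inside: "real k * \<tau> + \<tau> \<le> l" if "k \<in> A" for k
  proof -
    obtain i k' where *: "i \<in> G" "k' < L" "p + real k * \<tau> = p + real i * r + real k' * \<tau>"
      using A_cell[OF \<open>k \<in> A\<close>] by blast
    have "(real k' + 1) * \<tau> \<le> real L * \<tau>" using * \<tau> by (intro mult_right_mono) auto
    moreover have "(real i + 1) * r \<le> real M * r" using * r by (intro mult_right_mono) (auto simp: G_def)
    ultimately show ?thesis using * Mr(1) \<tau>(2) by (simp add: algebra_simps)
  qed
  have large: "49 / 200 * sqrt N \<le> norm (B x)"
    if "k \<in> A" "x \<in> {p + real k * \<tau>..p + real k * \<tau> + \<tau>}" for k x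
  proof -
    obtain i k' where *: "i \<in> G" "k' \<in> X i" "p + real k * \<tau> = p + real i * r + real k' * \<tau>"
      using A_cell[OF \<open>k \<in> A\<close>] by blast
    then obtain x0 where x0: "x0 \<in> {p + real k * \<tau>..p + real k * \<tau> + \<tau>}" "N / 16 \<le> (norm (B x0))\<^sup>2"
    proof -
      have "k' \<in> E i" using X(1) * by blast
      then show ?thesis using that unfolding E_def *(3) by blast
    qed
    have "sqrt (N / 16) \<le> norm (B x0)" using x0(2) by (intro real_le_lsqrt) auto
    moreover have "sqrt 16 = (4 :: real)" by (rule real_sqrt_unique) auto
    ultimately have "sqrt N / 4 \<le> norm (B x0)" by (simp only: real_sqrt_divide)
    moreover have "norm (B x0 - B x) < 1 / 200 * sqrt N"
    proof (rule \<delta>(2))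
      have "0 \<le> real k * \<tau>" using \<tau>(1) by simp
      then have "z \<in> {p..p + l}" if "z \<in> {p + real k * \<tau>..p + real k * \<tau> + \<tau>}" for z
        using that inside[OF \<open>k \<in> A\<close>] unfolding atLeastAtMost_iff by linarith
      then show "x0 \<in> {p..p + l}" "x \<in> {p..p + l}"
        using x0(1) that(2) by blast+
      show "\<bar>x0 - x\<bar> < \<delta>" using x0(1) that(2) \<tau>\<delta> by auto
    qed
    ultimately show ?thesis using norm_triangle_ineq2[of "B x0" "B x"] by linarith
  qed
  have total: "2 * l powr s \<le> card A * \<tau> powr s"
  proof -
    have "l / (2 * r * 13926400) \<le> card G"
    proof -
      have "M * r \<le> 13926400 * card G * r" using cardG r by (intro mult_right_mono) auto
      then have "l \<le> 2 * (13926400 * card G * r)" using Mr(2) by linarith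
      then show ?thesis using r by (simp add: field_simps)
    qed
    moreover have "v / \<tau> \<le> n0" using v_n0 \<tau> by (simp add: field_simps)
    ultimately have "l / (2 * r * 13926400) * (v / \<tau>) \<le> card A"
      unfolding cardA of_nat_mult using v \<tau> by (intro mult_mono) auto
    then have "l / (2 * r * 13926400) * (v / \<tau>) * \<tau> powr s \<le> card A * \<tau> powr s"
      by (intro mult_right_mono) auto
    moreover have "l / (2 * r * 13926400) * (v / \<tau>) * \<tau> powr s = 2 * l powr s * (q / \<tau> powr (1 - s))"
      using l \<tau> r by (simp add: q_def powr_diff field_simps)
    moreover have "2 * l powr s * 1 \<le> 2 * l powr s * (q / \<tau> powr (1 - s))"
      using \<tau>q \<tau> by (intro mult_left_mono) auto
    ultimately show ?thesis by linarith
  qed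
  have \<tau>l: "\<tau> \<le> l"
  proof -
    have "\<tau> \<le> r" using L0 r by (simp add: \<tau>_def field_simps)
    moreover have "1 * r \<le> real M * r"
      using r l0 by (intro mult_right_mono) (auto simp: zero_less_mult_iff)
    ultimately show ?thesis using Mr by linarith
  qed
  have count: "card {k\<in>A. {p + real k * \<tau>..p + real k * \<tau> + \<tau>} \<inter> {y..y + u} \<noteq> {}}
         \<le> 83558400 * real (card A) * (u / l) powr s" if "\<tau> \<le> u" "u \<le> l" for y u
  proof -
    have "r \<le> v powr s * l powr (1 - s)" using key by (simp add: r_def H_def v_def)
    from grid_count_le[OF \<tau>(1) L0 \<tau>(2) l s finA cardA cardG _ fibre v v_n0 Mr(2) this that]
    show ?thesis by simp
  qed
  show ?thesis
  proof (intro exI[of _ \<tau>] exI[of _ A] conjI ballI allI impI)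
    show "49 / 200 * sqrt N \<le> norm (\<Sum>n\<in>{N<..2 * N}. c n * unit_exp (x * F n))"
      if "k \<in> A" "x \<in> {p + real k * \<tau>..p + real k * \<tau> + \<tau>}" for k x
      using large[OF that] by (simp only: B_def A0_def)
  qed (fact \<tau>(1) \<tau>l finA total | rule inside count; assumption)+
qed

section \<open>Cantor sets and Hausdorff dimension\<close>

lemma sum_lengths_ge_of_cover:
  fixes y u :: "'i \<Rightarrow> real"
  assumes "finite X" "\<And>i. i \<in> X \<Longrightarrow> u i \<ge> 0" "l \<ge> 0"
    and "{p..p + l} \<subseteq> (\<Union>i\<in>X. {y i..y i + u i})"
  shows "l \<le> (\<Sum>i\<in>X. u i)"
proof -
  have "(\<Union>i\<in>X. {y i..y i + u i}) \<in> lmeasurable"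
    using assms(1) by (intro fmeasurable.finite_UN) auto
  then have "measure lebesgue {p..p + l} \<le> measure lebesgue (\<Union>i\<in>X. {y i..y i + u i})"
    using assms(4) by (intro measure_mono_fmeasurable) auto
  also have "\<dots> \<le> (\<Sum>i\<in>X. measure lebesgue {y i..y i + u i})"
    using assms(1) by (intro measure_UNION_le) auto
  also have "\<dots> = (\<Sum>i\<in>X. u i)"
    using assms(2) by (intro sum.cong) auto
  finally show ?thesis using assms(3) by simp
qed

lemma sum_powr_ge_of_cover:
  fixes y u :: "'i \<Rightarrow> real"
  assumes "finite X" "\<And>i. i \<in> X \<Longrightarrow> 0 < u i" "\<And>i. i \<in> X \<Longrightarrow> u i \<le> l" "0 < l" "0 < s" "s \<le> 1"
    and "{p..p + l} \<subseteq> (\<Union>i\<in>X. {y i..y i + u i})"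
  shows "l powr s \<le> (\<Sum>i\<in>X. u i powr s)"
proof -
  have "l \<le> (\<Sum>i\<in>X. u i)"
    using assms by (intro sum_lengths_ge_of_cover) (auto simp: less_imp_le)
  then have "1 \<le> (\<Sum>i\<in>X. u i / l)"
    using assms(4) by (simp add: sum_divide_distrib[symmetric])
  also have "\<dots> \<le> (\<Sum>i\<in>X. (u i / l) powr s)"
  proof (rule sum_mono)
    fix i assume i: "i \<in> X"
    have "(u i / l) powr 1 \<le> (u i / l) powr s"
      using assms(2,3)[OF i] assms(4-6) by (intro powr_mono') auto
    then show "u i / l \<le> (u i / l) powr s" using assms(2)[OF i] assms(4) by simp
  qed
  also have "\<dots> = (\<Sum>i\<in>X. u i powr s) / l powr s"
    using assms(2,4) by (simp add: powr_divide sum_divide_distrib less_imp_le)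
  finally show ?thesis using assms(4) by (simp add: field_simps)
qed

text \<open>A large cover interval destroys few children by the counting hypothesis; a small one meets at
  most two children, which the factor 2 in the mass hypothesis absorbs.\<close>

lemma content_step:
  fixes y u :: "'i \<Rightarrow> real" and \<tau> l s C p :: real and A :: "nat set"
  assumes X: "finite X" "\<And>i. i \<in> X \<Longrightarrow> 0 < u i" "\<And>i. i \<in> X \<Longrightarrow> u i < l"
    and l: "0 < l" and \<tau>: "0 < \<tau>" and C: "C > 0" and A: "finite A"
    and mass: "2 * l powr s \<le> card A * \<tau> powr s"
    and count: "\<And>z v. \<tau> \<le> v \<Longrightarrow> v \<le> l \<Longrightarrow>
      card {k\<in>A. {p + real k * \<tau>..p + real k * \<tau> + \<tau>} \<inter> {z..z + v} \<noteq> {}} \<le> C * card A * (v / l) powr s"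
    and children: "\<And>k Y. k \<in> A \<Longrightarrow> Y \<subseteq> X \<Longrightarrow>
      (\<And>i. i \<in> X \<Longrightarrow> {p + real k * \<tau>..p + real k * \<tau> + \<tau>} \<inter> {y i..y i + u i} \<noteq> {} \<Longrightarrow> i \<in> Y) \<Longrightarrow>
      \<tau> powr s / C \<le> (\<Sum>i\<in>Y. u i powr s)"
  shows "l powr s / C \<le> (\<Sum>i\<in>X. u i powr s)"
proof -
  define cell where "cell k = {p + real k * \<tau>..p + real k * \<tau> + \<tau>}" for k :: nat
  define J where "J i = {y i..y i + u i}" for i
  define Big where "Big = {i\<in>X. \<tau> \<le> u i}"
  define Small where "Small = {i\<in>X. u i < \<tau>}"
  \<comment> \<open>The children met by some large cover interval. The counting hypothesis makes
    their proportion at most \<open>C * L / l powr s\<close>.\<close>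
  define Hit where "Hit = (\<Union>i\<in>Big. {k\<in>A. cell k \<inter> J i \<noteq> {}})"
  define L where "L = (\<Sum>i\<in>Big. u i powr s)"
  define S where "S = (\<Sum>i\<in>Small. u i powr s)"
  have fin [simp]: "finite Big" "finite Small" using X by (auto simp: Big_def Small_def)
  have HitA: "Hit \<subseteq> A" by (auto simp: Hit_def)
  have total: "(\<Sum>i\<in>X. u i powr s) = L + S"
  proof -
    have "X = Big \<union> Small" by (auto simp: Big_def Small_def)
    then show ?thesis unfolding L_def S_def
      by (simp only:) (rule sum.union_disjoint, auto simp: Big_def Small_def X(1))
  qed
  have "real (card Hit) \<le> (\<Sum>i\<in>Big. real (card {k\<in>A. cell k \<inter> J i \<noteq> {}}))"
    unfolding Hit_def of_nat_sum[symmetric] of_nat_le_iff by (rule card_UN_le) simp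
  also have "\<dots> \<le> (\<Sum>i\<in>Big. C * card A * (u i / l) powr s)"
    unfolding cell_def J_def using X by (intro sum_mono count) (auto simp: Big_def less_imp_le)
  also have "\<dots> = C * card A * (L / l powr s)"
    unfolding L_def sum_divide_distrib sum_distrib_left using X l
    by (intro sum.cong) (auto simp: powr_divide Big_def less_imp_le)
  finally have hit: "real (card Hit) \<le> C * card A * (L / l powr s)" .
  \<comment> \<open>A child outside \<open>Hit\<close> is met only by small intervals, so these
    alone satisfy its content bound. After exchanging the sums, each small interval is counted at
    most twice, since an interval shorter than \<open>\<tau>\<close> meets fewer than three adjacent
    grid cells.\<close>
  have "real (card (A - Hit)) * (\<tau> powr s / C) = (\<Sum>k\<in>A - Hit. \<tau> powr s / C)" by simp
  also have "\<dots> \<le> (\<Sum>k\<in>A - Hit. \<Sum>i\<in>{i\<in>Small. cell k \<inter> J i \<noteq> {}}. u i powr s)"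
  proof (rule sum_mono)
    fix k assume k: "k \<in> A - Hit"
    have "i \<in> Small" if "i \<in> X" "cell k \<inter> J i \<noteq> {}" for i
    proof (rule ccontr)
      assume "i \<notin> Small"
      then have "i \<in> Big" using that by (auto simp: Small_def Big_def)
      then show False using k that by (auto simp: Hit_def)
    qed
    then show "\<tau> powr s / C \<le> (\<Sum>i\<in>{i\<in>Small. cell k \<inter> J i \<noteq> {}}. u i powr s)"
      using k by (intro children) (auto simp: cell_def[symmetric] J_def[symmetric] Small_def)
  qed
  also have "\<dots> = (\<Sum>i\<in>Small. \<Sum>k\<in>{k\<in>A - Hit. cell k \<inter> J i \<noteq> {}}. u i powr s)"
    using A by (intro sum.swap_restrict) auto
  also have "\<dots> \<le> (\<Sum>i\<in>Small. 2 * u i powr s)"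
  proof (rule sum_mono)
    fix i assume i: "i \<in> Small"
    then have ui: "0 < u i" "u i < \<tau>" using X by (auto simp: Small_def)
    have "real (card {k\<in>A - Hit. cell k \<inter> J i \<noteq> {}}) \<le> u i / \<tau> + 2"
      using card_grid_cells_meeting(2)[OF \<tau> less_imp_le[OF ui(1)], of "{k\<in>A - Hit. cell k \<inter> J i \<noteq> {}}" p "y i"]
      by (auto simp: cell_def J_def)
    moreover have "u i / \<tau> < 1" using ui \<tau> by simp
    ultimately have "card {k\<in>A - Hit. cell k \<inter> J i \<noteq> {}} \<le> 2" by linarith
    then have "real (card {k\<in>A - Hit. cell k \<inter> J i \<noteq> {}}) * u i powr s \<le> 2 * u i powr s"
      by (intro mult_right_mono) auto
    then show "(\<Sum>k\<in>{k\<in>A - Hit. cell k \<inter> J i \<noteq> {}}. u i powr s) \<le> 2 * u i powr s"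
      by simp
  qed
  also have "\<dots> = 2 * S" by (simp add: S_def sum_distrib_left)
  finally have unhit: "real (card (A - Hit)) * (\<tau> powr s / C) \<le> 2 * S" .
  have L0: "L \<ge> 0" "S \<ge> 0" by (auto simp: L_def S_def intro!: sum_nonneg)
  show ?thesis
  proof (cases "l powr s / C \<le> L")
    case True then show ?thesis using total L0 by simp
  next
    case False
    \<comment> \<open>A lower bound for the proportion of children outside \<open>Hit\<close>. Their
      content gives \<open>S \<ge> l powr s / C - L\<close>, which is exactly what the large
      intervals lack.\<close>
    define x where "x = 1 - C * (L / l powr s)"
    have x: "x > 0" using False C l by (simp add: x_def field_simps)
    have "real (card (A - Hit)) = card A - card Hit"
      using HitA A by (simp add: card_Diff_subset finite_subset card_mono of_nat_diff)
    then have "card A * x \<le> real (card (A - Hit))"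
      using hit by (simp add: x_def algebra_simps)
    then have "card A * x * (\<tau> powr s / C) \<le> 2 * S"
      using unhit mult_right_mono[of "card A * x" "real (card (A - Hit))" "\<tau> powr s / C"] C by simp
    moreover have "2 * l powr s * (x / C) \<le> card A * \<tau> powr s * (x / C)"
      using mass x C by (intro mult_right_mono) auto
    moreover have "card A * x * (\<tau> powr s / C) = card A * \<tau> powr s * (x / C)"
      "2 * l powr s * (x / C) = 2 * (l powr s * (x / C))" by simp_all
    ultimately have "l powr s * (x / C) \<le> S" by linarith
    moreover have "l powr s * (x / C) = l powr s / C - L"
      using C l by (simp add: x_def field_simps)
    ultimately show ?thesis using total by simp
  qed
qed

text \<open>Iterates the selection, imposing \<open>P j\<close> at stage \<open>j\<close>, and takes
  the intersection of all generations. The content bound has the same form for a parent and its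
  children, so it passes through every generation by induction with the same constant
  \<open>C\<close>; compactness carries it over to the limit set.\<close>

lemma Cantor_set_content:
  fixes P :: "nat \<Rightarrow> real \<Rightarrow> bool" and s C p0 l0 :: real
  assumes s: "0 < s" "s \<le> 1" and C: "C \<ge> 1" and l0: "0 < l0" "l0 \<le> 1"
    and step: "\<And>p l j. 0 < l \<Longrightarrow> l \<le> 1 \<Longrightarrow> \<exists>\<tau> A. 0 < \<tau> \<and> \<tau> \<le> l \<and> finite A \<and>
      (\<forall>k\<in>A. real k * \<tau> + \<tau> \<le> l) \<and>
      (\<forall>k\<in>A. \<forall>x\<in>{p + real k * \<tau>..p + real k * \<tau> + \<tau>}. P j x) \<and>
      2 * l powr s \<le> card A * \<tau> powr s \<and>
      (\<forall>y u. \<tau> \<le> u \<longrightarrow> u \<le> l \<longrightarrow>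
         card {k\<in>A. {p + real k * \<tau>..p + real k * \<tau> + \<tau>} \<inter> {y..y + u} \<noteq> {}}
           \<le> C * card A * (u / l) powr s)"
  obtains K where "compact K" "K \<subseteq> {p0..p0 + l0}" "\<And>x j. x \<in> K \<Longrightarrow> P j x"
    "\<And>(X :: nat set) y u. finite X \<Longrightarrow> (\<And>i. i \<in> X \<Longrightarrow> 0 < u i) \<Longrightarrow>
       K \<subseteq> (\<Union>i\<in>X. {y i<..<y i + u i}) \<Longrightarrow> l0 powr s / C \<le> (\<Sum>i\<in>X. u i powr s)"
proof -
  define good where "good j p l \<tau> A \<longleftrightarrow> 0 < \<tau> \<and> \<tau> \<le> l \<and> finite A \<and>
      (\<forall>k\<in>A. real k * \<tau> + \<tau> \<le> l) \<and>
      (\<forall>k\<in>A. \<forall>x\<in>{p + real k * \<tau>..p + real k * \<tau> + \<tau>}. P j x) \<and>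
      2 * l powr s \<le> card A * \<tau> powr s \<and>
      (\<forall>y u. \<tau> \<le> u \<longrightarrow> u \<le> l \<longrightarrow>
         card {k\<in>A. {p + real k * \<tau>..p + real k * \<tau> + \<tau>} \<inter> {y..y + u} \<noteq> {}}
           \<le> C * card A * (u / l) powr s)" for j p l \<tau> and A :: "nat set"
  define T where "T j p l = fst (SOME q. good j p l (fst q) (snd q))" for j p l
  define Ch where "Ch j p l = snd (SOME q. good j p l (fst q) (snd q))" for j p l
  have TCh: "good j p l (T j p l) (Ch j p l)" if "0 < l" "l \<le> 1" for j p l
  proof -
    have "\<exists>\<tau> A. good j p l \<tau> A"
      unfolding good_def by (rule step[OF that])
    then have "\<exists>q. good j p l (fst q) (snd q)" by simp
    then show ?thesis unfolding T_def Ch_def by (rule someI_ex)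
  qed
  \<comment> \<open>The union of the generation \<open>k\<close> intervals descending from
    \<open>{p..p + l}\<close>, with construction starting at stage \<open>j\<close>. The recursion
    splits off the first generation, so an induction hypothesis general in \<open>j\<close>,
    \<open>p\<close> and \<open>l\<close> applies to every child.\<close>
  define D :: "nat \<Rightarrow> nat \<Rightarrow> real \<Rightarrow> real \<Rightarrow> real set" where
    "D = rec_nat (\<lambda>j p l. {p..p + l})
       (\<lambda>_ rec j p l. \<Union>a\<in>Ch j p l. rec (Suc j) (p + real a * T j p l) (T j p l))"
  have D_0: "D 0 j p l = {p..p + l}"
    and D_Suc: "D (Suc k) j p l = (\<Union>a\<in>Ch j p l. D k (Suc j) (p + real a * T j p l) (T j p l))" for k j p l
    by (simp_all add: D_def)
  have T: "0 < T j p l" "T j p l \<le> 1" if "0 < l" "l \<le> 1" for j p l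
    using TCh[OF that, of j p] that by (auto simp: good_def)
  have cell_sub: "{p + real a * T j p l..p + real a * T j p l + T j p l} \<subseteq> {p..p + l}"
    if "0 < l" "l \<le> 1" "a \<in> Ch j p l" for a j p l
  proof -
    have "real a * T j p l + T j p l \<le> l" using TCh[OF that(1,2), of j p] that(3) by (auto simp: good_def)
    moreover have "0 \<le> real a * T j p l" using T[OF that(1,2), of j p] by simp
    ultimately show ?thesis by auto
  qed
  have compact_D: "compact (D k j p l)" if "0 < l" "l \<le> 1" for k j p l
    using that
  proof (induction k arbitrary: j p l)
    case (Suc k)
    have "finite (Ch j p l)" using TCh[OF Suc.prems] by (simp add: good_def)
    then show ?case unfolding D_Suc by (intro compact_UN Suc.IH T Suc.prems) auto
  qed (simp add: D_0)
  have D_sub: "D k j p l \<subseteq> {p..p + l}" if "0 < l" "l \<le> 1" for k j p l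
    using that
  proof (induction k arbitrary: j p l)
    case (Suc k)
    show ?case unfolding D_Suc
    proof (rule UN_least)
      fix a assume a: "a \<in> Ch j p l"
      show "D k (Suc j) (p + real a * T j p l) (T j p l) \<subseteq> {p..p + l}"
        using Suc.IH[OF T[OF Suc.prems]] cell_sub[OF Suc.prems a] by blast
    qed
  qed (simp add: D_0)
  have D_dec: "D (Suc k) j p l \<subseteq> D k j p l" if "0 < l" "l \<le> 1" for k j p l
    using that
  proof (induction k arbitrary: j p l)
    case 0
    then show ?case using D_sub[of l "Suc 0" j p] by (simp add: D_0)
  next
    case (Suc k)
    show ?case
      unfolding D_Suc[of "Suc k"] D_Suc[of k j p l] by (rule UN_mono[OF subset_refl Suc.IH]) (use T Suc.prems in auto)
  qed
  have D_P: "P (j + i) x" if "0 < l" "l \<le> 1" "x \<in> D k j p l" "i < k" for i k j p l x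
    using that
  proof (induction k arbitrary: i j p l)
    case (Suc k)
    obtain a where a: "a \<in> Ch j p l" "x \<in> D k (Suc j) (p + real a * T j p l) (T j p l)"
      using Suc.prems(3) unfolding D_Suc by blast
    show ?case
    proof (cases i)
      case 0
      have "x \<in> {p + real a * T j p l..p + real a * T j p l + T j p l}"
        using a(2) D_sub[OF T[OF Suc.prems(1,2)]] by blast
      then show ?thesis
        using TCh[OF Suc.prems(1,2), of j p] a(1) 0 by (auto simp: good_def)
    next
      case (Suc i')
      then show ?thesis
        using Suc.IH[OF T[OF Suc.prems(1,2)] a(2), of i'] Suc.prems(4) by simp
    qed
  qed simp
  have leC: "x / C \<le> x" if "x \<ge> 0" for x :: real
    using that C divide_left_mono[of 1 C x] by simp
  have content: "l powr s / C \<le> (\<Sum>i\<in>X. u i powr s)"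
    if "0 < l" "l \<le> 1" "finite X" "\<And>i. i \<in> X \<Longrightarrow> 0 < u i" "D k j p l \<subseteq> (\<Union>i\<in>X. {y i..y i + u i})"
    for k j p l y u and X :: "nat set"
    using that
  proof (induction k arbitrary: j p l X)
    case (0 j p l X)
    show ?case
    proof (cases "\<exists>i\<in>X. l \<le> u i")
      case True
      then obtain i where i: "i \<in> X" "l \<le> u i" by blast
      have "l powr s / C \<le> l powr s" by (rule leC) simp
      also have "\<dots> \<le> u i powr s" using i 0 s by (intro powr_mono2) auto
      also have "\<dots> \<le> (\<Sum>i\<in>X. u i powr s)" using i 0 by (intro member_le_sum) auto
      finally show ?thesis .
    next
      case False
      have "l powr s / C \<le> l powr s" by (rule leC) simp
      also have "\<dots> \<le> (\<Sum>i\<in>X. u i powr s)"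
        using 0 False s by (intro sum_powr_ge_of_cover) (auto simp: D_0 not_le less_imp_le)
      finally show ?thesis .
    qed
  next
    case (Suc k j p l X)
    show ?case
    proof (cases "\<exists>i\<in>X. l \<le> u i")
      case True
      then obtain i where i: "i \<in> X" "l \<le> u i" by blast
      have "l powr s / C \<le> l powr s" by (rule leC) simp
      also have "\<dots> \<le> u i powr s" using i Suc.prems s by (intro powr_mono2) auto
      also have "\<dots> \<le> (\<Sum>i\<in>X. u i powr s)" using i Suc.prems by (intro member_le_sum) auto
      finally show ?thesis .
    next
      case False
      have g: "good j p l (T j p l) (Ch j p l)" using TCh Suc.prems by blast
      show ?thesis
      \<comment> \<open>\<open>Y\<close> contains every cover interval that meets the child
        \<open>a\<close>, hence covers the descendants of \<open>a\<close>, and the induction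
        hypothesis bounds its sum.\<close>
      proof (rule content_step[of X u l "T j p l" C "Ch j p l" s p y])
        fix a Y
        assume a: "a \<in> Ch j p l" and Y: "Y \<subseteq> X"
          "\<And>i. i \<in> X \<Longrightarrow> {p + real a * T j p l..p + real a * T j p l + T j p l} \<inter> {y i..y i + u i} \<noteq> {} \<Longrightarrow> i \<in> Y"
        show "T j p l powr s / C \<le> (\<Sum>i\<in>Y. u i powr s)"
        proof (rule Suc.IH[OF T[OF Suc.prems(1,2)]])
          show "finite Y" using Y Suc.prems finite_subset by blast
          show "0 < u i" if "i \<in> Y" for i using Y Suc.prems that by blast
          show "D k (Suc j) (p + real a * T j p l) (T j p l) \<subseteq> (\<Union>i\<in>Y. {y i..y i + u i})"
          proof
            fix x assume x: "x \<in> D k (Suc j) (p + real a * T j p l) (T j p l)"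
            then have "x \<in> D (Suc k) j p l" unfolding D_Suc using a by blast
            then obtain i where i: "i \<in> X" "x \<in> {y i..y i + u i}" using Suc.prems(5) by blast
            have "x \<in> {p + real a * T j p l..p + real a * T j p l + T j p l}"
              using x D_sub[OF T[OF Suc.prems(1,2)]] by blast
            then have "i \<in> Y" using Y(2)[OF i(1)] i(2) by blast
            then show "x \<in> (\<Union>i\<in>Y. {y i..y i + u i})" using i(2) by blast
          qed
        qed
      qed (use g Suc.prems False C in \<open>auto simp: good_def not_le\<close>)
    qed
  qed
  define K where "K = (\<Inter>k. D k 0 p0 l0)"
  show ?thesis
  proof
    show "compact K" unfolding K_def using compact_D[OF l0] by (intro compact_Inter) auto
    show "K \<subseteq> {p0..p0 + l0}" unfolding K_def using D_sub[OF l0] by blast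
    show "P j x" if "x \<in> K" for x j
      using D_P[OF l0, of x "Suc j" 0 p0 j] that by (auto simp: K_def)
    fix X :: "nat set" and y u
    assume X: "finite X" "\<And>i. i \<in> X \<Longrightarrow> 0 < u i" "K \<subseteq> (\<Union>i\<in>X. {y i<..<y i + u i})"
    define U where "U = (\<Union>i\<in>X. {y i<..<y i + u i})"
    \<comment> \<open>The sets \<open>D k 0 p0 l0 - U\<close> are compact and decreasing because
      \<open>U\<close> is open. Their intersection is empty, so one of them is empty and a finite
      generation is already covered.\<close>
    have "\<exists>k. D k 0 p0 l0 - U = {}"
    proof (rule ccontr)
      assume "\<nexists>k. D k 0 p0 l0 - U = {}"
      moreover have "decseq (\<lambda>k. D k 0 p0 l0)"
        by (intro decseq_SucI D_dec l0)
      then have "D n 0 p0 l0 - U \<subseteq> D m 0 p0 l0 - U" if "m \<le> n" for m n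
        using that decseqD by blast
      ultimately have "(\<Inter>k. D k 0 p0 l0 - U) \<noteq> {}"
        by (intro compact_nest compact_diff compact_D l0) (auto simp: U_def)
      then show False using X(3) unfolding K_def U_def by blast
    qed
    then obtain k where "D k 0 p0 l0 \<subseteq> U" by blast
    also have "U \<subseteq> (\<Union>i\<in>X. {y i..y i + u i})"
      unfolding U_def by (intro UN_mono) auto
    finally have "D k 0 p0 l0 \<subseteq> (\<Union>i\<in>X. {y i..y i + u i})" .
    from content[OF l0 X(1,2) this] show "l0 powr s / C \<le> (\<Sum>i\<in>X. u i powr s)" .
  qed
qed

section \<open>From content bounds to Hausdorff dimension\<close>

lemma powr_diameter_le_diam_power:
  assumes "0 \<le> t" "t \<le> s" "0 < s" "bounded U" "diameter U \<le> 1"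
  shows "ennreal (diameter U powr s) \<le> diam_power t U"
proof (cases "t = 0")
  case True
  have "diameter U powr s \<le> 1"
    using assms diameter_ge_0[of U] by (intro powr_le1) auto
  then show ?thesis using True \<open>0 < s\<close> by (auto simp: diam_power_def)
next
  case False
  have "diameter U powr s \<le> diameter U powr t"
    using assms by (intro powr_mono' diameter_ge_0) auto
  then show ?thesis using False by (simp add: diam_power_def ennreal_leI)
qed

text \<open>If the measure of some dimension \<open>t < \<sigma>\<close> vanished, there would be
  covers with arbitrarily small sum. Enlarged to open intervals, such a cover has a finite subcover
  of \<open>K\<close>, and its sum contradicts the lower bound \<open>\<eta>\<close>.\<close>

lemma hausdorff_dim_ge:
  fixes E :: "real set"
  assumes "\<sigma> > 0" "\<sigma> \<le> 1" and content: "\<And>s. 0 < s \<Longrightarrow> s < \<sigma> \<Longrightarrow> \<exists>K \<eta>. compact K \<and> K \<subseteq> E \<and> \<eta> > 0 \<and>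
    (\<forall>(X :: nat set) y u. finite X \<longrightarrow> (\<forall>i\<in>X. 0 < u i) \<longrightarrow> K \<subseteq> (\<Union>i\<in>X. {y i<..<y i + u i}) \<longrightarrow>
       \<eta> \<le> (\<Sum>i\<in>X. u i powr s))"
  shows "hausdorff_dim E \<ge> ereal \<sigma>"
  unfolding hausdorff_dim_def
proof (rule INF_greatest, clarify)
  fix t :: real assume t: "0 \<le> t" "hausdorff_measure t E = 0"
  show "ereal \<sigma> \<le> ereal t"
  proof (rule ccontr)
    assume "\<not> ereal \<sigma> \<le> ereal t"
    then have "t < \<sigma>" by simp
    \<comment> \<open>Keeps the exponent positive even for \<open>t = 0\<close>; raising the
      exponent only decreases powers of diameters that are at most 1.\<close>
    define s where "s = max t (\<sigma> / 2)"
    have s: "0 < s" "s < \<sigma>" "t \<le> s" using \<open>t < \<sigma>\<close> \<open>\<sigma> > 0\<close> by (auto simp: s_def)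
    obtain K \<eta> where K: "compact K" "K \<subseteq> E" "\<eta> > 0"
      "\<And>(X :: nat set) y u. finite X \<Longrightarrow> (\<And>i. i \<in> X \<Longrightarrow> 0 < u i) \<Longrightarrow> K \<subseteq> (\<Union>i\<in>X. {y i<..<y i + u i}) \<Longrightarrow>
       \<eta> \<le> (\<Sum>i\<in>X. u i powr s)"
      using content[OF s(1,2)] by metis
    have "hausdorff_premeasure t 1 E \<le> hausdorff_measure t E"
      unfolding hausdorff_measure_def by (rule SUP_upper) simp
    then have "hausdorff_premeasure t 1 E < ennreal (\<eta> / 32)" using t K(3) by simp
    then obtain U where U: "E \<subseteq> (\<Union>i::nat. U i)" "\<And>i. bounded (U i)" "\<And>i. diameter (U i) \<le> 1"
        "(\<Sum>i. diam_power t (U i)) < ennreal (\<eta> / 32)"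
      unfolding hausdorff_premeasure_def INF_less_iff by auto
    define d where "d i = diameter (U i)" for i
    have d: "0 \<le> d i" "d i \<le> 1" for i using U by (auto simp: d_def diameter_ge_0)
    \<comment> \<open>A positive margin that makes even a single point sit inside a nondegenerate
      open interval. The powers \<open>\<rho> i powr s\<close> form a geometric series with sum
      \<open>\<eta> / 32\<close>, so the final sum is at most 4 (\<eta> / 32 + \<eta> / 32) = \<eta>
      / 4.\<close>
    define \<rho> where "\<rho> i = (\<eta> / 64 * (1 / 2) ^ i) powr (1 / s)" for i :: nat
    have \<rho>: "\<rho> i > 0" "\<rho> i powr s = \<eta> / 64 * (1 / 2) ^ i" for i
      using K(3) s by (auto simp: \<rho>_def powr_powr)
    define m where "m i = max (d i) (\<rho> i)" for i
    have m: "m i > 0" for i using \<rho>(1)[of i] by (simp add: m_def)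
    define z where "z i = (SOME x. x \<in> U i)" for i
    define y where "y i = z i - 2 * m i" for i
    define u where "u i = 4 * m i" for i
    have cover: "U i \<subseteq> {y i<..<y i + u i}" for i
    proof
      fix x assume x: "x \<in> U i"
      then have "z i \<in> U i" unfolding z_def by (rule someI)
      then have "dist x (z i) \<le> m i"
        using diameter_bounded_bound[OF U(2) x] by (force simp: m_def d_def)
      then show "x \<in> {y i<..<y i + u i}" using m[of i] by (auto simp: y_def u_def dist_real_def)
    qed
    have "K \<subseteq> (\<Union>i\<in>UNIV. {y i<..<y i + u i})" using K(2) U(1) cover by blast
    then obtain X where X: "finite X" "K \<subseteq> (\<Union>i\<in>X. {y i<..<y i + u i})"
      using compactE_image[OF K(1), of UNIV "\<lambda>i. {y i<..<y i + u i}"] by auto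
    have "\<eta> \<le> (\<Sum>i\<in>X. u i powr s)"
      using X m by (intro K(4)) (auto simp: u_def)
    also have "\<dots> \<le> (\<Sum>i\<in>X. 4 * (d i powr s + \<rho> i powr s))"
    proof (rule sum_mono)
      fix i
      have "(4::real) powr s \<le> 4 powr 1"
        using s(2) \<open>\<sigma> \<le> 1\<close> by (intro powr_mono) auto
      have "u i powr s = 4 powr s * m i powr s" using m[of i] by (simp add: u_def powr_mult)
      also have "\<dots> \<le> 4 * (d i powr s + \<rho> i powr s)"
        using \<open>4 powr s \<le> 4 powr 1\<close> by (intro mult_mono) (auto simp: m_def max_def)
      finally show "u i powr s \<le> 4 * (d i powr s + \<rho> i powr s)" .
    qed
    also have "\<dots> = 4 * (\<Sum>i\<in>X. d i powr s) + 4 * (\<Sum>i\<in>X. \<rho> i powr s)"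
      by (simp add: sum.distrib sum_distrib_left)
    also have "(\<Sum>i\<in>X. d i powr s) \<le> \<eta> / 32"
    proof -
      have "ennreal (\<Sum>i\<in>X. d i powr s) = (\<Sum>i\<in>X. ennreal (d i powr s))"
        by (simp add: sum_ennreal)
      also have "\<dots> \<le> (\<Sum>i\<in>X. diam_power t (U i))"
        unfolding d_def using U t s by (intro sum_mono powr_diameter_le_diam_power) auto
      also have "\<dots> \<le> (\<Sum>i. diam_power t (U i))"
        by (intro sum_le_suminf X(1)) auto
      also have "\<dots> \<le> ennreal (\<eta> / 32)" using U(4) by simp
      finally show ?thesis using K(3) by simp
    qed
    also have "(\<Sum>i\<in>X. \<rho> i powr s) \<le> \<eta> / 32"
    proof -
      have "(\<Sum>i\<in>X. \<rho> i powr s) = \<eta> / 64 * (\<Sum>i\<in>X. (1 / 2) ^ i)"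
        by (simp add: \<rho>(2) sum_distrib_left)
      also have "(\<Sum>i\<in>X. (1 / 2 :: real) ^ i) \<le> (\<Sum>i. (1 / 2) ^ i)"
        by (intro sum_le_suminf X(1) summable_geometric) auto
      also have "(\<Sum>i. (1 / 2 :: real) ^ i) = 2"
        using suminf_geometric[of "1 / 2 :: real"] by simp
      finally show ?thesis using K(3) by simp
    qed
    finally show False using K(3) by simp
  qed
qed

section \<open>Growth of the phase\<close>

text \<open>Integrates the growth of \<open>f''\<close> by the mean value theorem, from a fixed
  \<open>T\<close> for the upper bound and over \<open>{t / 2..t}\<close> for the lower one.\<close>

lemma derivative_growth:
  fixes \<gamma> \<epsilon> :: real and f' f'' :: "real \<Rightarrow> real"
  assumes "\<gamma> > 2" "\<epsilon> > 0"
    and deriv: "\<And>t. t > 0 \<Longrightarrow> (f' has_real_derivative f'' t) (at t)"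
    and bounds: "\<And>\<epsilon>. \<epsilon> > 0 \<Longrightarrow>
           \<forall>\<^sub>F t in at_top. t powr (\<gamma> - 2 - \<epsilon>) \<le> f'' t \<and> f'' t \<le> t powr (\<gamma> - 2 + \<epsilon>)"
  shows "\<forall>\<^sub>F t in at_top. t powr (\<gamma> - 1 - \<epsilon>) \<le> f' t \<and> f' t \<le> t powr (\<gamma> - 1 + \<epsilon>)"
proof -
  \<comment> \<open>Strictly below \<open>\<epsilon>\<close>, so that constants such as
    \<open>f' T\<close> and powers of 2 are absorbed; at most \<open>\<gamma> - 2\<close>, so that
    the powers bounding \<open>f''\<close> are nondecreasing.\<close>
  define e where "e = min (\<epsilon> / 2) ((\<gamma> - 2) / 2)"
  have e: "0 < e" "e < \<epsilon>" "e \<le> \<gamma> - 2" using assms(1,2) by (auto simp: e_def min_def field_simps)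
  obtain T0 where T0: "\<And>t. t \<ge> T0 \<Longrightarrow> t powr (\<gamma> - 2 - e) \<le> f'' t \<and> f'' t \<le> t powr (\<gamma> - 2 + e)"
    using bounds[OF e(1)] unfolding eventually_at_top_linorder by blast
  define T where "T = max 1 T0"
  have T: "T \<ge> 1" "\<And>t. t \<ge> T \<Longrightarrow> t powr (\<gamma> - 2 - e) \<le> f'' t" "\<And>t. t \<ge> T \<Longrightarrow> f'' t \<le> t powr (\<gamma> - 2 + e)"
    using T0 by (auto simp: T_def)
  have MVT: "\<exists>z. a < z \<and> z < b \<and> f' b - f' a = (b - a) * f'' z" if "T \<le> a" "a < b" for a b
    using that T(1) by (intro MVT2) (auto intro!: deriv)
  have upper: "f' t \<le> f' T + t powr (\<gamma> - 1 + e)" if "t > T" for t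
  proof -
    obtain z where z: "T < z" "z < t" "f' t - f' T = (t - T) * f'' z"
      using MVT[of T t] \<open>t > T\<close> by auto
    have "(t - T) * f'' z \<le> t * t powr (\<gamma> - 2 + e)"
    proof (rule mult_mono)
      have "z powr (\<gamma> - 2 + e) \<le> t powr (\<gamma> - 2 + e)"
        using z T(1) e by (intro powr_mono2) auto
      then show "f'' z \<le> t powr (\<gamma> - 2 + e)" using T(3)[of z] z by linarith
      show "0 \<le> f'' z" using T(2)[of z] z powr_ge_zero[of z "\<gamma> - 2 - e"] by linarith
    qed (use that T in auto)
    also have "t * t powr (\<gamma> - 2 + e) = t powr (1 + (\<gamma> - 2 + e))"
      using that T(1) by (subst powr_add) simp
    finally show ?thesis using z(3) by (simp add: algebra_simps)
  qed
  have mono: "f' T \<le> f' t" if "t \<ge> T" for t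
  proof (cases "t = T")
    case False
    then obtain z where z: "T < z" "z < t" "f' t - f' T = (t - T) * f'' z"
      using MVT[of T t] \<open>t \<ge> T\<close> by auto
    have "0 \<le> f'' z" using T(2)[of z] z powr_ge_zero[of z "\<gamma> - 2 - e"] by linarith
    then have "0 \<le> (t - T) * f'' z" using that by simp
    then show ?thesis using z(3) by linarith
  qed simp
  have lower: "f' T + (t / 2) powr (\<gamma> - 1 - e) \<le> f' t" if "t \<ge> 2 * T" for t
  proof -
    have t: "T \<le> t / 2" "t / 2 < t" using that T(1) by auto
    obtain z where z: "t / 2 < z" "z < t" "f' t - f' (t / 2) = (t - t / 2) * f'' z" using MVT[OF t] by auto
    have "(t / 2) powr (\<gamma> - 2 - e) \<le> z powr (\<gamma> - 2 - e)"
      using z t T(1) e by (intro powr_mono2) auto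
    then have "(t / 2) powr (\<gamma> - 2 - e) \<le> f'' z" using T(2)[of z] z t by linarith
    then have "(t / 2) * (t / 2) powr (\<gamma> - 2 - e) \<le> (t / 2) * f'' z"
      using t T(1) by (intro mult_left_mono) auto
    moreover have "(t / 2) * (t / 2) powr (\<gamma> - 2 - e) = (t / 2) powr (1 + (\<gamma> - 2 - e))"
      using t T(1) by (subst powr_add) simp
    ultimately show ?thesis using z(3) mono[OF t(1)] by (simp add: algebra_simps)
  qed
  have "\<forall>\<^sub>F t in at_top. f' T + t powr (\<gamma> - 1 + e) \<le> t powr (\<gamma> - 1 + \<epsilon>)"
  proof -
    have "0 < \<gamma> - 1 + e" "\<gamma> - 1 + e < \<gamma> - 1 + \<epsilon>" using assms(1) e by auto
    then show ?thesis by real_asymp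
  qed
  moreover have "\<forall>\<^sub>F t in at_top. t powr (\<gamma> - 1 - \<epsilon>) \<le> f' T + (t / 2) powr (\<gamma> - 1 - e)"
  proof -
    have "0 < \<gamma> - 1 - e" "\<gamma> - 1 - \<epsilon> < \<gamma> - 1 - e" using assms(1) e by auto
    then show ?thesis by real_asymp
  qed
  moreover have "\<forall>\<^sub>F t in at_top. t \<ge> 2 * T + 1" by (rule eventually_ge_at_top)
  ultimately show ?thesis
  proof eventually_elim
    case (elim t)
    then show ?case using upper[of t] lower[of t] T(1) by linarith
  qed
qed

text \<open>Applies the mean value theorem to the difference with step \<open>d\<close> and then to
  \<open>f'\<close>. As \<open>d\<close> is at least 1, the separation is uniform in the gap, which
  is the convexity input of \<open>block_step\<close>.\<close>

lemma mean_value_second_difference: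
  fixes f f' f'' :: "real \<Rightarrow> real"
  assumes f: "\<And>t. t > 0 \<Longrightarrow> (f has_real_derivative f' t) (at t)"
    and f': "\<And>t. t > 0 \<Longrightarrow> (f' has_real_derivative f'' t) (at t)"
    and lower: "\<And>t. t \<ge> a \<Longrightarrow> g \<le> f'' t" "g \<ge> 0"
    and "0 < a" "a \<le> y" "y < z" "d \<ge> 1"
  shows "g * (z - y) \<le> (f (z + d) - f z) - (f (y + d) - f y)"
proof -
  have deriv: "((\<lambda>t. f (t + d) - f t) has_real_derivative f' (t + d) - f' t) (at t)" if "t > 0" for t
    using f[of "t + d"] f[OF that] that \<open>d \<ge> 1\<close> by (intro DERIV_diff) (auto simp: DERIV_shift)
  have "\<exists>\<xi>. y < \<xi> \<and> \<xi> < z \<and> (f (z + d) - f z) - (f (y + d) - f y) = (z - y) * (f' (\<xi> + d) - f' \<xi>)"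
    by (rule MVT2[of y z "\<lambda>t. f (t + d) - f t" "\<lambda>t. f' (t + d) - f' t"]) (use assms(5-8) deriv in auto)
  then obtain \<xi> where \<xi>: "y < \<xi>" "(f (z + d) - f z) - (f (y + d) - f y) = (z - y) * (f' (\<xi> + d) - f' \<xi>)"
    by blast
  have "\<exists>\<eta>. \<xi> < \<eta> \<and> \<eta> < \<xi> + d \<and> f' (\<xi> + d) - f' \<xi> = (\<xi> + d - \<xi>) * f'' \<eta>"
    by (rule MVT2) (use \<xi>(1) assms(5-8) f' in auto)
  then obtain \<eta> where \<eta>: "\<xi> < \<eta>" "f' (\<xi> + d) - f' \<xi> = (\<xi> + d - \<xi>) * f'' \<eta>"
    by blast
  have "g * 1 \<le> f'' \<eta> * d"
    using lower(1)[of \<eta>] lower(2) assms(5-8) \<xi>(1) \<eta>(1) by (intro mult_mono) auto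
  then have "g \<le> f' (\<xi> + d) - f' \<xi>" using \<eta>(2) by (simp add: mult.commute)
  then have "(z - y) * g \<le> (z - y) * (f' (\<xi> + d) - f' \<xi>)"
    using assms(5-8) by (intro mult_left_mono) auto
  then show ?thesis using \<xi>(2) by (simp add: mult.commute)
qed

text \<open>The origin of the dimension. It is the \<open>key\<close> condition of
  \<open>block_step\<close> for a block at \<open>x\<close>: the left side is \<open>x\<close> to
  the power - (\<gamma> - 1 / 2 - \<epsilon>), the right side a constant times \<open>x\<close> to
  the power - s (\<gamma> + \<epsilon>). As \<epsilon> tends to 0 the requirement becomes s <
  (\<gamma> - 1 / 2) / \<gamma> = 1 - 1 / (2 \<gamma>).\<close>

lemma exponent_comparison:
  fixes s l \<kappa> \<gamma> \<epsilon> :: real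
  assumes l: "0 < l" and \<kappa>: "\<kappa> > 0" and exponents: "s * (\<gamma> + \<epsilon>) < \<gamma> - 1 / 2 - \<epsilon>"
  shows "\<forall>\<^sub>F x in at_top. 1 / (x powr (\<gamma> - 1 - \<epsilon>) * sqrt x) \<le>
           (1 / (\<kappa> * (2 * x) powr (\<gamma> - 1 + \<epsilon>) * x)) powr s * l powr (1 - s)"
proof -
  define M where "M = \<kappa> * 2 powr (\<gamma> - 1 + \<epsilon>)"
  define \<delta> where "\<delta> = \<gamma> - 1 / 2 - \<epsilon> - s * (\<gamma> + \<epsilon>)"
  have M: "M > 0" using \<kappa> by (simp add: M_def)
  have "\<delta> > 0" using exponents by (simp add: \<delta>_def)
  moreover have "l powr (1 - s) > 0" using l by simp
  ultimately have "\<forall>\<^sub>F x in at_top. M powr s \<le> x powr \<delta> * l powr (1 - s)" by real_asymp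
  moreover have "\<forall>\<^sub>F x :: real in at_top. x > 0" by (rule eventually_gt_at_top)
  ultimately show ?thesis
  proof eventually_elim
    case (elim x)
    have "M powr s * x powr (s * (\<gamma> + \<epsilon>)) \<le> x powr \<delta> * l powr (1 - s) * x powr (s * (\<gamma> + \<epsilon>))"
      using elim by (intro mult_right_mono) auto
    also have "\<dots> = l powr (1 - s) * x powr (\<gamma> - 1 / 2 - \<epsilon>)"
      by (simp add: \<delta>_def powr_add[symmetric])
    finally have main: "M powr s * x powr (s * (\<gamma> + \<epsilon>)) \<le> l powr (1 - s) * x powr (\<gamma> - 1 / 2 - \<epsilon>)" .
    have lhs: "x powr (\<gamma> - 1 - \<epsilon>) * sqrt x = x powr (\<gamma> - 1 / 2 - \<epsilon>)"
    proof -
      have "x powr (\<gamma> - 1 / 2 - \<epsilon>) = x powr ((\<gamma> - 1 - \<epsilon>) + 1 / 2)"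
        by (intro arg_cong2[of x x _ _ "(powr)"]) auto
      also have "\<dots> = x powr (\<gamma> - 1 - \<epsilon>) * x powr (1 / 2)" by (rule powr_add)
      finally show ?thesis using elim by (simp add: powr_half_sqrt)
    qed
    have "\<kappa> * (2 * x) powr (\<gamma> - 1 + \<epsilon>) * x = M * (x powr (\<gamma> - 1 + \<epsilon>) * x powr 1)"
      using elim by (simp add: M_def powr_mult)
    also have "x powr (\<gamma> - 1 + \<epsilon>) * x powr 1 = x powr (\<gamma> + \<epsilon>)"
      by (subst powr_add[symmetric]) (simp add: algebra_simps)
    finally have rhs: "(1 / (\<kappa> * (2 * x) powr (\<gamma> - 1 + \<epsilon>) * x)) powr s = 1 / (M powr s * x powr (s * (\<gamma> + \<epsilon>)))"
      using M elim by (simp add: powr_divide powr_mult powr_powr mult.commute)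
    have "1 / v \<le> 1 / u * t" if "u \<le> t * v" "u > 0" "v > 0" for t u v :: real
      using that by (simp add: field_simps)
    from this[OF main] show ?case
      unfolding lhs rhs using M elim by simp
  qed
qed

text \<open>One stage of the Cantor construction. All hypotheses of \<open>block_step\<close> hold
  once the block is far enough out, so it can be placed beyond any given \<open>N0\<close> and
  adapted to any length \<open>l\<close>.\<close>

lemma large_sums_step:
  fixes \<gamma> s p l :: real and f f' f'' :: "real \<Rightarrow> real" and a :: "nat \<Rightarrow> complex" and N0 :: nat
  assumes \<gamma>: "\<gamma> > 2"
    and f: "\<And>t. t > 0 \<Longrightarrow> (f has_real_derivative f' t) (at t)"
    and f': "\<And>t. t > 0 \<Longrightarrow> (f' has_real_derivative f'' t) (at t)"
    and bounds: "\<And>\<epsilon>. \<epsilon> > 0 \<Longrightarrow>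
           \<forall>\<^sub>F t in at_top. t powr (\<gamma> - 2 - \<epsilon>) \<le> f'' t \<and> f'' t \<le> t powr (\<gamma> - 2 + \<epsilon>)"
    and a: "\<And>n. n \<ge> 1 \<Longrightarrow> norm (a n) = 1"
    and s: "0 < s" "s < 1 - 1 / (2 * \<gamma>)" and l: "0 < l" "l \<le> 1"
  shows "\<exists>\<tau> A. 0 < \<tau> \<and> \<tau> \<le> l \<and> finite A \<and> (\<forall>k\<in>A. real k * \<tau> + \<tau> \<le> l) \<and>
    (\<forall>k\<in>A. \<forall>x\<in>{p + real k * \<tau>..p + real k * \<tau> + \<tau>}.
       \<exists>N\<ge>N0. 1 / 10 * sqrt (real N) \<le> norm (\<Sum>n=1..N. a n * unit_exp (x * f (real n)))) \<and>
    2 * l powr s \<le> card A * \<tau> powr s \<and>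
    (\<forall>y u. \<tau> \<le> u \<longrightarrow> u \<le> l \<longrightarrow>
       card {k\<in>A. {p + real k * \<tau>..p + real k * \<tau> + \<tau>} \<inter> {y..y + u} \<noteq> {}}
         \<le> 83558400 * real (card A) * (u / l) powr s)"
proof -
  have "1 / (2 * \<gamma>) > 0" using \<gamma> by simp
  then have s1: "s < 1" using s(2) by linarith
  have s\<gamma>: "s * \<gamma> < \<gamma> - 1 / 2"
  proof -
    have "s * \<gamma> < (1 - 1 / (2 * \<gamma>)) * \<gamma>" using s \<gamma> by (intro mult_strict_right_mono) auto
    moreover have "(1 - 1 / (2 * \<gamma>)) * \<gamma> = \<gamma> - 1 / 2" using \<gamma> by (simp add: field_simps)
    ultimately show ?thesis by linarith
  qed
  \<comment> \<open>The first bound makes the lower bound for \<open>f'\<close> grow faster than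
    linearly and the one for \<open>f''\<close> grow as a power; the second leaves room for
    \<open>exponents\<close>.\<close>
  define \<epsilon> where "\<epsilon> = min ((\<gamma> - 2) / 4) ((\<gamma> - 1 / 2 - s * \<gamma>) / 4)"
  have \<epsilon>: "\<epsilon> > 0" "4 * \<epsilon> \<le> \<gamma> - 2" "4 * \<epsilon> \<le> \<gamma> - 1 / 2 - s * \<gamma>"
    using \<gamma> s\<gamma> by (auto simp: \<epsilon>_def min_def)
  have exponents: "s * (\<gamma> + \<epsilon>) < \<gamma> - 1 / 2 - \<epsilon>"
  proof -
    have "s * \<epsilon> < 1 * \<epsilon>" using s1 \<epsilon> by (intro mult_strict_right_mono) auto
    moreover have "s * (\<gamma> + \<epsilon>) = s * \<gamma> + s * \<epsilon>" by (rule distrib_left)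
    ultimately show ?thesis using \<epsilon> by linarith
  qed
  define g where "g x = x powr (\<gamma> - 2 - \<epsilon>)" for x :: real
  obtain T where T: "\<And>t. t \<ge> T \<Longrightarrow> g t \<le> f'' t"
      "\<And>t. t \<ge> T \<Longrightarrow> t powr (\<gamma> - 1 - \<epsilon>) \<le> f' t" "\<And>t. t \<ge> T \<Longrightarrow> f' t \<le> t powr (\<gamma> - 1 + \<epsilon>)"
  proof -
    have "\<forall>\<^sub>F t in at_top. g t \<le> f'' t \<and> t powr (\<gamma> - 1 - \<epsilon>) \<le> f' t \<and> f' t \<le> t powr (\<gamma> - 1 + \<epsilon>)"
    proof -
      have "\<forall>\<^sub>F t in at_top. t powr (\<gamma> - 1 - \<epsilon>) \<le> f' t \<and> f' t \<le> t powr (\<gamma> - 1 + \<epsilon>)"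
        using \<gamma> \<epsilon>(1) f' bounds by (rule derivative_growth)
      with bounds[OF \<epsilon>(1)] show ?thesis
        by eventually_elim (auto simp: g_def)
    qed
    then show ?thesis using that unfolding eventually_at_top_linorder by meson
  qed
  have "\<forall>\<^sub>F x in at_top. 4 * x \<le> x powr (\<gamma> - 1 - \<epsilon>) * l"
  proof -
    have "1 < \<gamma> - 1 - \<epsilon>" using \<epsilon> by linarith
    then show ?thesis using l(1) by real_asymp
  qed
  moreover have "\<forall>\<^sub>F x in at_top. 4 * (1 + ln x) \<le> g x * (l / 2)"
  proof -
    have "0 < \<gamma> - 2 - \<epsilon>" "0 < l / 2" using \<epsilon> l by linarith+
    then show ?thesis unfolding g_def by real_asymp
  qed
  moreover have "\<forall>\<^sub>F x in at_top. 1 / (x powr (\<gamma> - 1 - \<epsilon>) * sqrt x) \<le>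
           (1 / (167116800 * (2 * x) powr (\<gamma> - 1 + \<epsilon>) * x)) powr s * l powr (1 - s)"
    by (rule exponent_comparison[OF l(1) _ exponents]) simp
  moreover have "\<forall>\<^sub>F x in at_top. x \<ge> max T (max 1 (real N0))" by (rule eventually_ge_at_top)
  ultimately have "\<forall>\<^sub>F x in at_top. 4 * x \<le> x powr (\<gamma> - 1 - \<epsilon>) * l \<and> 4 * (1 + ln x) \<le> g x * (l / 2) \<and>
     1 / (x powr (\<gamma> - 1 - \<epsilon>) * sqrt x) \<le>
           (1 / (167116800 * (2 * x) powr (\<gamma> - 1 + \<epsilon>) * x)) powr s * l powr (1 - s) \<and>
     x \<ge> max T (max 1 (real N0))"
    by eventually_elim auto
  from eventually_compose_filterlim[OF this filterlim_real_sequentially]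
  obtain N :: nat where N: "4 * N \<le> N powr (\<gamma> - 1 - \<epsilon>) * l" "4 * (1 + ln N) \<le> g N * (l / 2)"
     "1 / (N powr (\<gamma> - 1 - \<epsilon>) * sqrt N) \<le>
           (1 / (167116800 * (2 * N) powr (\<gamma> - 1 + \<epsilon>) * N)) powr s * l powr (1 - s)"
     "T \<le> N" "1 \<le> real N" "N0 \<le> N"
    unfolding eventually_sequentially by auto
  have N1: "N \<ge> 1" using N(5) by simp
  have f'_mono: "f' x \<le> f' y" if "N \<le> x" "x \<le> y" for x y :: real
  proof (rule DERIV_nonneg_imp_nondecreasing[OF that(2)])
    fix t assume "x \<le> t" "t \<le> y"
    then have "t > 0" "t \<ge> T" using that N by auto
    moreover have "0 \<le> f'' t" using T(1)[OF \<open>t \<ge> T\<close>] powr_ge_zero[of t "\<gamma> - 2 - \<epsilon>"]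
      unfolding g_def by linarith
    ultimately show "\<exists>y. (f' has_real_derivative y) (at t) \<and> 0 \<le> y" using f' by blast
  qed
  have MVT: "\<exists>z. x < z \<and> z < y \<and> f y - f x = (y - x) * f' z" if "N \<le> x" "x < y" for x y :: real
    using that N by (intro MVT2) (auto intro!: f)
  define D where "D = f' N"
  define D' where "D' = f' (2 * N)"
  have D: "N powr (\<gamma> - 1 - \<epsilon>) \<le> D" unfolding D_def using T N by simp
  have D_pos: "0 < D" using D N1 by (smt (verit) powr_gt_zero of_nat_0_less_iff less_le_trans zero_less_one)
  have D': "D \<le> D'" unfolding D_def D'_def using f'_mono[of N "2 * N"] N by simp
  have D'_le: "D' \<le> (2 * N) powr (\<gamma> - 1 + \<epsilon>)" unfolding D'_def using T(3)[of "2 * N"] N by simp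
  have "\<exists>\<tau> A. 0 < \<tau> \<and> \<tau> \<le> l \<and> finite A \<and> (\<forall>k\<in>A. real k * \<tau> + \<tau> \<le> l) \<and>
    (\<forall>k\<in>A. \<forall>x\<in>{p + real k * \<tau>..p + real k * \<tau> + \<tau>}.
       49 / 200 * sqrt N \<le> norm (\<Sum>n\<in>{N<..2 * N}. a n * unit_exp (x * f (real n)))) \<and>
    2 * l powr s \<le> card A * \<tau> powr s \<and>
    (\<forall>y u. \<tau> \<le> u \<longrightarrow> u \<le> l \<longrightarrow>
       card {k\<in>A. {p + real k * \<tau>..p + real k * \<tau> + \<tau>} \<inter> {y..y + u} \<noteq> {}}
         \<le> 83558400 * real (card A) * (u / l) powr s)"
  proof (rule block_step[where D = D and D' = D' and g = "g N"])
    show "D * (real m - real n) \<le> f (real m) - f (real n)" if nm: "N < n" "n < m" "m \<le> 2 * N" for n m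
    proof -
      obtain z where z: "real n < z" "f (real m) - f (real n) = (real m - real n) * f' z"
        using MVT[of n m] nm by auto
      have "(real m - real n) * D \<le> (real m - real n) * f' z"
        unfolding D_def using f'_mono[of N z] nm z(1) by (intro mult_left_mono) auto
      then show ?thesis using z(2) by (simp add: mult.commute)
    qed
    show "f (real (2 * N)) - f (real (N + 1)) \<le> D' * N"
    \<comment> \<open>For \<open>N = 1\<close> the block is a single index and the mean value
      theorem has no interval to work on.\<close>
    proof (cases "N = 1")
      case True
      then have "2 * N = N + 1" by simp
      then show ?thesis using D_pos D' by simp
    next
      case False
      then have "real (N + 1) < real (2 * N)" using N1 by simp
      then obtain z where z: "real (N + 1) < z" "z < real (2 * N)"
          "f (real (2 * N)) - f (real (N + 1)) = (real (2 * N) - real (N + 1)) * f' z"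
        using MVT[of "real (N + 1)" "real (2 * N)"] by auto
      have "(real (2 * N) - real (N + 1)) * f' z \<le> N * D'"
        unfolding D'_def
      proof (rule mult_mono)
        show "f' z \<le> f' (2 * N)" using f'_mono[of z "2 * N"] z by simp
        show "0 \<le> f' z" using f'_mono[of N z] z D_pos by (simp add: D_def)
      qed (use N1 in auto)
      then show ?thesis using z(3) by (simp add: mult.commute)
    qed
    show "g N * (real y' - real y) \<le> f (real (y' + d)) - f (real y') - (f (real (y + d)) - f (real y))"
      if "N < y" "y < y'" "1 \<le> d" "y' + d \<le> 2 * N" for y y' d
    proof -
      have "g N \<le> f'' t" if "t \<ge> N" for t :: real
      proof -
        have "g N \<le> g t" unfolding g_def using that N \<epsilon> by (intro powr_mono2) auto
        then show ?thesis using T(1)[of t] that N by linarith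
      qed
      then have "g N * (real y' - real y) \<le> (f (real y' + real d) - f (real y')) - (f (real y + real d) - f (real y))"
        using that N1 f f'
        by (intro mean_value_second_difference[where a = N and f' = f' and f'' = f'']) (auto simp: g_def)
      then show ?thesis by simp
    qed
    have "harm N - ln (real N) \<le> harm 1 - ln (real 1)"
      by (rule euler_mascheroni_sequence_decreasing) (use N1 in auto)
    then have "4 * harm N \<le> 4 * (1 + ln N)" by (simp add: harm_def)
    then show "4 * harm N \<le> g N * (l / 2)" using N(2) by linarith
    have "N powr (\<gamma> - 1 - \<epsilon>) * l \<le> D * l" using D l by (intro mult_right_mono) auto
    then show "real (4 * N) \<le> D * l" using N(1) by linarith
    have "1 / (D * sqrt N) \<le> 1 / (N powr (\<gamma> - 1 - \<epsilon>) * sqrt N)"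
      using D D_pos N1 by (intro divide_left_mono mult_right_mono mult_pos_pos) auto
    also have "\<dots> \<le> (1 / (167116800 * (2 * N) powr (\<gamma> - 1 + \<epsilon>) * N)) powr s * l powr (1 - s)"
      by (rule N(3))
    also have "\<dots> \<le> (1 / (167116800 * D' * N)) powr s * l powr (1 - s)"
      using D'_le D' D_pos N1 s
      by (intro mult_right_mono powr_mono2 divide_left_mono mult_left_mono mult_pos_pos) auto
    finally show "1 / (D * sqrt N) \<le> (1 / (167116800 * D' * N)) powr s * l powr (1 - s)" .
  qed (use N1 l s s1 D' a in \<open>auto simp: g_def\<close>)
  then obtain \<tau> A where step: "0 < \<tau>" "\<tau> \<le> l" "finite A" "\<forall>k\<in>A. real k * \<tau> + \<tau> \<le> l"
    "\<forall>k\<in>A. \<forall>x\<in>{p + real k * \<tau>..p + real k * \<tau> + \<tau>}.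
       49 / 200 * sqrt N \<le> norm (\<Sum>n\<in>{N<..2 * N}. a n * unit_exp (x * f (real n)))"
    "2 * l powr s \<le> card A * \<tau> powr s"
    "\<forall>y u. \<tau> \<le> u \<longrightarrow> u \<le> l \<longrightarrow>
       card {k\<in>A. {p + real k * \<tau>..p + real k * \<tau> + \<tau>} \<inter> {y..y + u} \<noteq> {}}
         \<le> 83558400 * real (card A) * (u / l) powr s"
    by blast
  \<comment> \<open>The block sum is the difference of the partial sums at \<open>2 * N\<close> and
    \<open>N\<close>. As \<open>sqrt 2 \<le> 29 / 20\<close>, two partial sums below the threshold
    would give less than (1 + 29 / 20) / 10 = 49 / 200 times \<open>sqrt N\<close>.\<close>
  have transfer: "\<exists>M\<ge>N0. 1 / 10 * sqrt (real M) \<le> norm (\<Sum>n=1..M. a n * unit_exp (x * f (real n)))"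
    if large: "49 / 200 * sqrt N \<le> norm (\<Sum>n\<in>{N<..2 * N}. a n * unit_exp (x * f (real n)))" for x
  proof (rule ccontr)
    define S where "S M = (\<Sum>n=1..M. a n * unit_exp (x * f (real n)))" for M
    assume "\<not> ?thesis"
    then have "norm (S M) < 1 / 10 * sqrt M" if "M \<ge> N0" for M
      using that unfolding S_def by (meson not_le)
    from this[of N] this[of "2 * N"]
    have "norm (S N) < 1 / 10 * sqrt N" "norm (S (2 * N)) < 1 / 10 * sqrt (real (2 * N))"
      using N(6) by simp_all
    moreover have "sqrt (real (2 * N)) \<le> 29 / 20 * sqrt N"
    proof -
      have "sqrt 2 \<le> (29 / 20 :: real)" by (rule real_le_lsqrt) (auto simp: power2_eq_square)
      from mult_right_mono[OF this, of "sqrt N"] show ?thesis by (simp add: real_sqrt_mult)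
    qed
    moreover have "S (2 * N) - S N = (\<Sum>n\<in>{N<..2 * N}. a n * unit_exp (x * f (real n)))"
    proof -
      have "{1..2 * N} = {1..N} \<union> {N<..2 * N}" using N1 by auto
      then have "S (2 * N) = S N + (\<Sum>n\<in>{N<..2 * N}. a n * unit_exp (x * f (real n)))"
        unfolding S_def by (simp only:) (rule sum.union_disjoint, auto)
      then show ?thesis by simp
    qed
    moreover have "norm (S (2 * N) - S N) \<le> norm (S (2 * N)) + norm (S N)"
      by (rule norm_triangle_ineq4)
    ultimately show False using large by (simp only:)
  qed
  show ?thesis
  proof (intro exI[of _ \<tau>] exI[of _ A] conjI ballI)
    fix k x assume "k \<in> A" "x \<in> {p + real k * \<tau>..p + real k * \<tau> + \<tau>}"
    then show "\<exists>N\<ge>N0. 1 / 10 * sqrt (real N) \<le> norm (\<Sum>n=1..N. a n * unit_exp (x * f (real n)))"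
      by (intro transfer step(5)[rule_format])
  qed (fact step(1-3,6,7) | rule step(4)[rule_format], assumption)+
qed

theorem theorem2p6:
  fixes \<gamma> :: real and f f' f'' :: "real \<Rightarrow> real"
  assumes "\<gamma> > 2"
    and "\<And>t. t > 0 \<Longrightarrow> (f has_real_derivative f' t) (at t)"
    and "\<And>t. t > 0 \<Longrightarrow> (f' has_real_derivative f'' t) (at t)"
    and "continuous_on {0<..} f''"
    and "\<And>\<epsilon>. \<epsilon> > 0 \<Longrightarrow>
           \<forall>\<^sub>F t in at_top. t powr (\<gamma> - 2 - \<epsilon>) \<le> f'' t \<and> f'' t \<le> t powr (\<gamma> - 2 + \<epsilon>)"
  shows "\<exists>c::real. c > 0 \<and>
    (\<forall>a :: nat \<Rightarrow> complex. (\<forall>n\<ge>1. norm (a n) = 1) \<longrightarrow>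
      (\<forall>I :: real set. is_interval I \<and> interior I \<noteq> {} \<longrightarrow>
        hausdorff_dim {x \<in> I. infinite {N :: nat.
            norm (\<Sum>n=1..N. a n * unit_exp (x * f (real n))) \<ge> c * sqrt (real N)}}
          \<ge> ereal (1 - 1 / (2 * \<gamma>))))"
\<comment> \<open>The witness is an absolute constant; it depends on neither \<open>f\<close> nor
  the coefficients.\<close>
proof (intro exI[of _ "1 / 10 :: real"] conjI allI impI)
  fix a :: "nat \<Rightarrow> complex" and I :: "real set"
  assume a: "\<forall>n\<ge>1. norm (a n) = 1" and I: "is_interval I \<and> interior I \<noteq> {}"
  define S where "S x N = norm (\<Sum>n=1..N. a n * unit_exp (x * f (real n)))" for x and N :: nat
  define E where "E = {x \<in> I. infinite {N :: nat. S x N \<ge> 1 / 10 * sqrt (real N)}}"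
  obtain p where "p \<in> interior I" using I by blast
  then obtain e where e: "e > 0" "cball p e \<subseteq> interior I"
    using open_contains_cball[of "interior I"] by auto
  define l0 where "l0 = min e 1"
  have l0: "0 < l0" "l0 \<le> 1" using e by (auto simp: l0_def)
  have sub_I: "{p..p + l0} \<subseteq> I"
  proof -
    have "{p..p + l0} \<subseteq> cball p e" by (auto simp: l0_def dist_real_def)
    then show ?thesis using e(2) interior_subset by blast
  qed
  have "hausdorff_dim E \<ge> ereal (1 - 1 / (2 * \<gamma>))"
  proof (rule hausdorff_dim_ge)
    show "0 < 1 - 1 / (2 * \<gamma>)" "1 - 1 / (2 * \<gamma>) \<le> 1" using \<open>\<gamma> > 2\<close> by (auto simp: field_simps)
    fix s assume s: "0 < s" "s < 1 - 1 / (2 * \<gamma>)"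
    then have "s \<le> 1" using \<open>1 - 1 / (2 * \<gamma>) \<le> 1\<close> by linarith
    have a': "norm (a n) = 1" if "n \<ge> 1" for n using a that by blast
    obtain K where K: "compact K" "K \<subseteq> {p..p + l0}" "\<And>x j. x \<in> K \<Longrightarrow> \<exists>N\<ge>j. 1 / 10 * sqrt (real N) \<le> S x N"
      "\<And>(X :: nat set) y u. finite X \<Longrightarrow> (\<And>i. i \<in> X \<Longrightarrow> 0 < u i) \<Longrightarrow>
         K \<subseteq> (\<Union>i\<in>X. {y i<..<y i + u i}) \<Longrightarrow> l0 powr s / 83558400 \<le> (\<Sum>i\<in>X. u i powr s)"
    \<comment> \<open>Stage \<open>j\<close> demands a large partial sum at some
      \<open>N \<ge> j\<close>. A point that satisfies all stages has large partial sums for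
      unboundedly many \<open>N\<close>.\<close>
    proof (rule Cantor_set_content[where s = s and C = 83558400 and ?p0.0 = p and ?l0.0 = l0
        and P = "\<lambda>j x. \<exists>N\<ge>j. 1 / 10 * sqrt (real N) \<le> S x N"])
      fix q l :: real and j :: nat
      assume "0 < l" "l \<le> 1"
      from large_sums_step[where p = q and ?N0.0 = j, OF assms(1-3,5) a' s this]
      show "\<exists>\<tau> A. 0 < \<tau> \<and> \<tau> \<le> l \<and> finite A \<and> (\<forall>k\<in>A. real k * \<tau> + \<tau> \<le> l) \<and>
        (\<forall>k\<in>A. \<forall>x\<in>{q + real k * \<tau>..q + real k * \<tau> + \<tau>}. \<exists>N\<ge>j. 1 / 10 * sqrt (real N) \<le> S x N) \<and>
        2 * l powr s \<le> card A * \<tau> powr s \<and>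
        (\<forall>y u. \<tau> \<le> u \<longrightarrow> u \<le> l \<longrightarrow>
           card {k\<in>A. {q + real k * \<tau>..q + real k * \<tau> + \<tau>} \<inter> {y..y + u} \<noteq> {}}
             \<le> 83558400 * real (card A) * (u / l) powr s)"
        unfolding S_def by simp
    qed (use s l0 \<open>s \<le> 1\<close> in auto)
    have "K \<subseteq> E"
      using K(2,3) sub_I unfolding E_def infinite_nat_iff_unbounded_le by auto
    moreover have "l0 powr s / 83558400 > 0" using l0 by simp
    ultimately show "\<exists>K \<eta>. compact K \<and> K \<subseteq> E \<and> \<eta> > 0 \<and>
      (\<forall>(X :: nat set) y u. finite X \<longrightarrow> (\<forall>i\<in>X. 0 < u i) \<longrightarrow> K \<subseteq> (\<Union>i\<in>X. {y i<..<y i + u i}) \<longrightarrow>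
         \<eta> \<le> (\<Sum>i\<in>X. u i powr s))"
      using K(1,4) by (intro exI[of _ K] exI[of _ "l0 powr s / 83558400"] conjI allI impI) auto
  qed
  then show "hausdorff_dim {x \<in> I. infinite {N :: nat.
      norm (\<Sum>n=1..N. a n * unit_exp (x * f (real n))) \<ge> 1 / 10 * sqrt (real N)}}
        \<ge> ereal (1 - 1 / (2 * \<gamma>))"
    by (simp only: E_def S_def)
qed simp

end
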